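(* Let $s\ge 2$, $r\ge1$ and $n_0,\dots,n_{s-1}$ be positive integers. The torus-fixed points of $\mathcal N(r,n_0,\dots,n_{s-1})$ are in one-to-one correspondence with the $s$-tuples of nested coloured partitions $\boldsymbol\mu_1\subseteq\cdots\subseteq\boldsymbol\mu_{s-1}\subseteq\boldsymbol\mu_0$ with $|\boldsymbol\mu_0|=n_0$ and $|\boldsymbol\mu_i|=n_0-n_i$ for $1\le i\le s-1$. Here the torus is $\mathbb T=(\mathbb C^* )^2\times(\mathbb C^* )^r$.
   Context: A coloured partition is an $r$-tuple $\boldsymbol\mu=(\mu^1,\dots,\mu^r)$ of partitions, with $|\boldsymbol\mu|=|\mu^1|+\cdots+|\mu^r|$; $\boldsymbol\mu\subseteq\boldsymbol\nu$ means that the Young diagram of $\mu^a$ is contained in that of $\nu^a$ for every $a=1,\dots,r$. The moduli space $\mathcal N(r,\mathbf n)$, with $N=s-1$: fix complex vector spaces $W,V_0,\dots,V_N$ with $\dim W=r$, $\dim V_i=n_i$. Let $\mathbb X_0$ be the scheme of tuples $X=(B_1^0,B_2^0,I,J,\{B_1^i,B_2^i,F^i,G^i\}_{i=1}^N)$ with $B_1^i,B_2^i\in\mathrm{End}(V_i)$ for $0\le i\le N$, $I\in\mathrm{Hom}(W,V_0)$, $J\in\mathrm{Hom}(V_0,W)$, $F^i\in\mathrm{Hom}(V_i,V_{i-1})$, $G^i\in\mathrm{Hom}(V_{i-1},V_i)$ for $1\le i\le N$, satisfying $[B_1^0,B_2^0]+IJ=0$, $JF^1=0$, $G^1I=0$,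 and for all $1\le i\le N$, $a=1,2$: $[B_1^i,B_2^i]=0$, $B_a^{i-1}F^i-F^iB_a^i=0$, $G^iB_a^{i-1}-B_a^iG^i=0$, $F^iG^i=0$. The group $\mathcal G=GL(V_0)\times\cdots\times GL(V_N)$ acts by $B_a^i\mapsto g_iB_a^ig_i^{-1}$, $I\mapsto g_0I$, $J\mapsto Jg_0^{-1}$, $F^i\mapsto g_{i-1}F^ig_i^{-1}$, $G^i\mapsto g_iG^ig_{i-1}^{-1}$. A datum is stable if every $F^i$ is injective and there is no proper subspace $S\subsetneq V_0$ with $B_1^0(S),B_2^0(S)\subseteq S$ and $\mathrm{Im}(I)\subseteq S$. $\mathcal N(r,\mathbf n)$ is the GIT moduli space of $\mathcal G$-orbits of stable data in $\mathbb X_0$. Torus action: $(t_1,t_2,\rho)\in(\mathbb C^* )^2\times(\mathbb C^* )^r$, with $\rho$ acting diagonally on $W$, acts by $B_1^i\mapsto t_1B_1^i$, $B_2^i\mapsto t_2B_2^i$, $I\mapsto I\rho^{-1}$, $J\mapsto t_1t_2\rho J$, $F^i\mapsto F^i$ (on stable data all $G^i$ vanish). *)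

theory Defs
  imports
    "HOL-Algebra.Group_Action"
    "HOL-Algebra.Product_Groups"
    "Jordan_Normal_Form.VS_Connect"
begin

text \<open>
  The spaces are taken in coordinates, \<open>W = \<complex>\<^sup>r\<close> and \<open>V\<^sub>i = \<complex>\<^bsup>n i\<^esup>\<close> for \<open>i < s\<close>, so that linear maps are
  matrices; the torus acts diagonally with respect to the standard basis of \<open>W\<close>.
  The families indexed by \<open>i\<close> are extensional functions (\<open>undefined\<close> off the index
  range), so that equality of records is equality of data.
\<close>

record nested_adhm =
  fB1 :: "nat \<Rightarrow> complex mat"
  fB2 :: "nat \<Rightarrow> complex mat"
  fI :: "complex mat"
  fJ :: "complex mat"
  fF :: "nat \<Rightarrow> complex mat"
  fG :: "nat \<Rightarrow> complex mat"

definition nested_adhm_maps :: "nat \<Rightarrow> nat \<Rightarrow> (nat \<Rightarrow> nat) \<Rightarrow> nested_adhm set" where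
  "nested_adhm_maps r s n = {X.
     fB1 X \<in> (\<Pi>\<^sub>E i\<in>{..<s}. carrier_mat (n i) (n i)) \<and>
     fB2 X \<in> (\<Pi>\<^sub>E i\<in>{..<s}. carrier_mat (n i) (n i)) \<and>
     fI X \<in> carrier_mat (n 0) r \<and>
     fJ X \<in> carrier_mat r (n 0) \<and>
     fF X \<in> (\<Pi>\<^sub>E i\<in>{1..<s}. carrier_mat (n (i - 1)) (n i)) \<and>
     fG X \<in> (\<Pi>\<^sub>E i\<in>{1..<s}. carrier_mat (n i) (n (i - 1)))}"

text \<open>The complex points of the scheme \<open>\<bbbX>\<^sub>0\<close>.\<close>

definition nested_adhm_data :: "nat \<Rightarrow> nat \<Rightarrow> (nat \<Rightarrow> nat) \<Rightarrow> nested_adhm set" where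
  "nested_adhm_data r s n = {X \<in> nested_adhm_maps r s n.
     (fB1 X 0 * fB2 X 0 - fB2 X 0 * fB1 X 0) + fI X * fJ X = 0\<^sub>m (n 0) (n 0) \<and>
     fJ X * fF X 1 = 0\<^sub>m r (n 1) \<and>
     fG X 1 * fI X = 0\<^sub>m (n 1) r \<and>
     (\<forall>i\<in>{1..<s}.
        fB1 X i * fB2 X i - fB2 X i * fB1 X i = 0\<^sub>m (n i) (n i) \<and>
        fB1 X (i - 1) * fF X i - fF X i * fB1 X i = 0\<^sub>m (n (i - 1)) (n i) \<and>
        fB2 X (i - 1) * fF X i - fF X i * fB2 X i = 0\<^sub>m (n (i - 1)) (n i) \<and>
        fG X i * fB1 X (i - 1) - fB1 X i * fG X i = 0\<^sub>m (n i) (n (i - 1)) \<and>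
        fG X i * fB2 X (i - 1) - fB2 X i * fG X i = 0\<^sub>m (n i) (n (i - 1)) \<and>
        fF X i * fG X i = 0\<^sub>m (n (i - 1)) (n (i - 1)))}"

definition stable :: "nat \<Rightarrow> nat \<Rightarrow> (nat \<Rightarrow> nat) \<Rightarrow> nested_adhm \<Rightarrow> bool" where
  "stable r s n X \<longleftrightarrow>
     (\<forall>i\<in>{1..<s}. inj_on (\<lambda>v. fF X i *\<^sub>v v) (carrier_vec (n i))) \<and>
     \<not> (\<exists>S. VectorSpace.subspace class_ring S (module_vec TYPE(complex) (n 0)) \<and>
            S \<subset> carrier_vec (n 0) \<and>
            (\<lambda>v. fB1 X 0 *\<^sub>v v) ` S \<subseteq> S \<and>
            (\<lambda>v. fB2 X 0 *\<^sub>v v) ` S \<subseteq> S \<and>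
            (\<lambda>w. fI X *\<^sub>v w) ` carrier_vec r \<subseteq> S)"

definition GL :: "nat \<Rightarrow> complex mat monoid" where
  "GL m = units_of (ring_mat TYPE(complex) m ())"

definition gauge_group :: "nat \<Rightarrow> (nat \<Rightarrow> nat) \<Rightarrow> (nat \<Rightarrow> complex mat) monoid" where
  "gauge_group s n = product_group {..<s} (\<lambda>i. GL (n i))"

definition gauge_action ::
  "nat \<Rightarrow> (nat \<Rightarrow> nat) \<Rightarrow> (nat \<Rightarrow> complex mat) \<Rightarrow> nested_adhm \<Rightarrow> nested_adhm" where
  "gauge_action s n g X = \<lparr>
     fB1 = (\<lambda>i\<in>{..<s}. g i * fB1 X i * inv\<^bsub>GL (n i)\<^esub> (g i)),
     fB2 = (\<lambda>i\<in>{..<s}. g i * fB2 X i * inv\<^bsub>GL (n i)\<^esub> (g i)),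
     fI = g 0 * fI X,
     fJ = fJ X * inv\<^bsub>GL (n 0)\<^esub> (g 0),
     fF = (\<lambda>i\<in>{1..<s}. g (i - 1) * fF X i * inv\<^bsub>GL (n i)\<^esub> (g i)),
     fG = (\<lambda>i\<in>{1..<s}. g i * fG X i * inv\<^bsub>GL (n (i - 1))\<^esub> (g (i - 1)))\<rparr>"

text \<open>The GIT moduli space, as the set of its complex points: the orbits of stable data.\<close>

definition moduli_space :: "nat \<Rightarrow> nat \<Rightarrow> (nat \<Rightarrow> nat) \<Rightarrow> nested_adhm set set" where
  "moduli_space r s n =
     orbits (gauge_group s n) {X \<in> nested_adhm_data r s n. stable r s n X} (gauge_action s n)"

definition torus :: "nat \<Rightarrow> (complex \<times> complex \<times> (nat \<Rightarrow> complex)) set" where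
  "torus r = (UNIV - {0}) \<times> (UNIV - {0}) \<times> (\<Pi>\<^sub>E a\<in>{..<r}. UNIV - {0})"

text \<open>The maps \<open>G\<^sup>i\<close> vanish on stable data, so their weight is immaterial; it is taken trivial.\<close>

fun torus_action ::
  "nat \<Rightarrow> nat \<Rightarrow> complex \<times> complex \<times> (nat \<Rightarrow> complex) \<Rightarrow> nested_adhm \<Rightarrow> nested_adhm" where
  "torus_action r s (t1, t2, \<rho>) X = \<lparr>
     fB1 = (\<lambda>i\<in>{..<s}. t1 \<cdot>\<^sub>m fB1 X i),
     fB2 = (\<lambda>i\<in>{..<s}. t2 \<cdot>\<^sub>m fB2 X i),
     fI = fI X * mat_diag r (\<lambda>a. inverse (\<rho> a)),
     fJ = (t1 * t2) \<cdot>\<^sub>m (mat_diag r \<rho> * fJ X),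
     fF = fF X,
     fG = fG X\<rparr>"

text \<open>
  The torus action commutes with the gauge action, hence acts on orbits by taking images.
\<close>

definition torus_fixed_points :: "nat \<Rightarrow> nat \<Rightarrow> (nat \<Rightarrow> nat) \<Rightarrow> nested_adhm set set" where
  "torus_fixed_points r s n =
     {\<O> \<in> moduli_space r s n. \<forall>t \<in> torus r. torus_action r s t ` \<O> = \<O>}"

text \<open>A partition is the weakly decreasing list of its (positive) parts.\<close>

definition is_partition :: "nat list \<Rightarrow> bool" where
  "is_partition p \<longleftrightarrow> sorted_wrt (\<ge>) p \<and> (\<forall>k\<in>set p. 0 < k)"

definition young_diagram :: "nat list \<Rightarrow> (nat \<times> nat) set" where
  "young_diagram p = {(i, j). i < length p \<and> j < p ! i}"

definition coloured_partitions :: "nat \<Rightarrow> nat list list set" where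
  "coloured_partitions r = {\<mu>. length \<mu> = r \<and> (\<forall>p\<in>set \<mu>. is_partition p)}"

definition coloured_size :: "nat list list \<Rightarrow> nat" where
  "coloured_size \<mu> = sum_list (map sum_list \<mu>)"

text \<open>Only meaningful for coloured partitions with the same number of colours.\<close>

definition coloured_subset :: "nat list list \<Rightarrow> nat list list \<Rightarrow> bool" where
  "coloured_subset \<mu> \<nu> \<longleftrightarrow> (\<forall>a<length \<mu>. young_diagram (\<mu> ! a) \<subseteq> young_diagram (\<nu> ! a))"

text \<open>
  An \<open>s\<close>-tuple is a list \<open>[\<mu>\<^sub>0, \<mu>\<^sub>1, \<dots>]\<close> of length \<open>s\<close>, nested as
  \<open>\<mu>\<^sub>1 \<subseteq> \<dots> \<subseteq> \<mu>\<^bsub>s - 1\<^esub> \<subseteq> \<mu>\<^sub>0\<close>. The condition \<open>|\<mu>\<^sub>i| = n\<^sub>0 - n\<^sub>i\<close> is written additively, since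
  subtraction of natural numbers truncates: no tuple exists when \<open>n\<^sub>i > n\<^sub>0\<close>.
\<close>

definition nested_coloured_partitions ::
  "nat \<Rightarrow> nat \<Rightarrow> (nat \<Rightarrow> nat) \<Rightarrow> nat list list list set" where
  "nested_coloured_partitions r s n = {\<mu>.
     length \<mu> = s \<and> set \<mu> \<subseteq> coloured_partitions r \<and>
     (\<forall>i\<in>{1..<s - 1}. coloured_subset (\<mu> ! i) (\<mu> ! (i + 1))) \<and>
     coloured_subset (\<mu> ! (s - 1)) (\<mu> ! 0) \<and>
     coloured_size (\<mu> ! 0) = n 0 \<and>
     (\<forall>i\<in>{1..<s}. coloured_size (\<mu> ! i) + n i = n 0)}"

end

theory Submission
  imports Defs "Jordan_Normal_Form.Spectral_Radius"
begin

text \<open>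
  Since \<open>F\<^sup>1 \<cdots> F\<^sup>k\<close> embeds \<open>V\<^sub>k\<close> in \<open>V\<^sub>0\<close>, a stable datum is a flag of subspaces of \<open>V\<^sub>0\<close>, and \<open>V\<^sub>0\<close> is
  generated by the image of \<open>I\<close>. Let the orbit of a stable datum be fixed by the single torus
  element \<open>t\<^sub>1 = 2\<close>, \<open>t\<^sub>2 = 3\<close>, \<open>\<rho>\<^sub>a = 5\<^bsup>-a\<^esup>\<close>, and let \<open>g\<close> be the gauge transformation realising this. Words of
  type \<open>(i, j)\<close> in \<open>B\<^sub>1, B\<^sub>2\<close> applied to \<open>I w\<^sub>a\<close> are eigenvectors of \<open>g\<^sub>0\<close> for \<open>2\<^sup>i 3\<^sup>j 5\<^sup>a\<close>. A parity
  argument on these eigenvalues gives \<open>J = 0\<close>, so \<open>B\<^sub>1\<close> and \<open>B\<^sub>2\<close> commute; as the eigenvalues are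
  pairwise distinct, the nonzero vectors \<open>B\<^sub>1\<^sup>i B\<^sub>2\<^sup>j I w\<^sub>a\<close> form a basis of \<open>V\<^sub>0\<close>, and those lying in
  the \<open>g\<^sub>0\<close>-invariant image of \<open>V\<^sub>k\<close> form a basis of that image. In these bases the datum consists of
  0/1 shift matrices determined by the sets of boxes \<open>(a, i, j)\<close> involved, which are gauge invariants;
  conversely such a shift datum is stable and diagonal gauge transformations show that the whole torus
  fixes its orbit.
\<close>

section \<open>Orbits of the gauge group\<close>

text \<open>The usual argument lifts the torus to the gauge group and splits every space into weight
  spaces. One torus element suffices here because its weights on the monomials are already pairwise
  distinct: 2, 3 and 5 are different primes, so unique factorisation separates the boxes, and the
  required weight spaces are eigenspaces of one matrix. The order of the steps is forced. Until J =
  0 is known, \<open>B_1\<close> and \<open>B_2\<close> need not commute and the ordered monomials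
  need not span V_0, so J = 0 has to be shown with arbitrary eigenvectors of the right eigenvalues.
  One separation argument for distinct eigenvalues then serves twice, for linear independence and
  for splitting elements of an invariant subspace. Partitions are complements of the boxes of V_k
  because the image of V_k is a submodule of V_0: its boxes are closed upward inside the diagram of
  V_0, whereas the quotient is again generated by the image of I and its boxes are closed
  downward.\<close>

lemma GL_I:
  assumes "g \<in> carrier_mat m m" "h \<in> carrier_mat m m" "g * h = 1\<^sub>m m" "h * g = 1\<^sub>m m"
  shows "g \<in> carrier (GL m)" "inv\<^bsub>GL m\<^esub> g = h"
proof -
  interpret ring "ring_mat TYPE(complex) m ()" by (rule ring_mat)
  have G: "group (GL m)" unfolding GL_def by (rule units_group)
  show g: "g \<in> carrier (GL m)"
    using assms unfolding GL_def units_of_carrier Units_def by (auto simp: ring_mat_simps)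
  have h: "h \<in> carrier (GL m)"
    using assms unfolding GL_def units_of_carrier Units_def by (auto simp: ring_mat_simps)
  show "inv\<^bsub>GL m\<^esub> g = h"
    using group.inv_equality[OF G _ g h] assms
    by (simp add: GL_def units_of_mult units_of_one ring_mat_simps)
qed

lemma GL_D:
  assumes "g \<in> carrier (GL m)"
  shows "g \<in> carrier_mat m m" "inv\<^bsub>GL m\<^esub> g \<in> carrier_mat m m"
    "g * inv\<^bsub>GL m\<^esub> g = 1\<^sub>m m" "inv\<^bsub>GL m\<^esub> g * g = 1\<^sub>m m"
    "inv\<^bsub>GL m\<^esub> g \<in> carrier (GL m)"
proof -
  obtain h where h: "g \<in> carrier_mat m m" "h \<in> carrier_mat m m" "g * h = 1\<^sub>m m" "h * g = 1\<^sub>m m"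
    using assms unfolding GL_def units_of_carrier Units_def by (auto simp: ring_mat_simps)
  note i = GL_I(2)[OF h]
  show "g \<in> carrier_mat m m" "inv\<^bsub>GL m\<^esub> g \<in> carrier_mat m m"
    "g * inv\<^bsub>GL m\<^esub> g = 1\<^sub>m m" "inv\<^bsub>GL m\<^esub> g * g = 1\<^sub>m m"
    "inv\<^bsub>GL m\<^esub> g \<in> carrier (GL m)" using h GL_I(1)[of h m g] by (auto simp: i)
qed

lemma GL_mult:
  assumes g: "g \<in> carrier (GL m)" and h: "h \<in> carrier (GL m)"
  shows "g * h \<in> carrier (GL m)"
proof -
  interpret ring "ring_mat TYPE(complex) m ()" by (rule ring_mat)
  have "group (GL m)" unfolding GL_def by (rule units_group)
  from group.is_monoid[OF this, THEN monoid.m_closed, OF g h] show ?thesis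
    by (simp add: GL_def units_of_mult ring_mat_simps)
qed

text \<open>Clears the inverse from the action formulas. Only \<open>h\<close> has to be invertible,
  so J is covered by taking \<open>g\<close> to be the identity of W.\<close>

lemma conj_eq_iff:
  assumes g: "g \<in> carrier_mat a a" and h: "h \<in> carrier (GL b)"
    and A: "A \<in> carrier_mat a b" "A' \<in> carrier_mat a b"
  shows "g * A * inv\<^bsub>GL b\<^esub> h = A' \<longleftrightarrow> g * A = A' * h"
proof -
  note H = GL_D[OF h]
  have gA: "g * A \<in> carrier_mat a b" using g A by simp
  have "g * A * inv\<^bsub>GL b\<^esub> h * h = g * A" "A' * h * inv\<^bsub>GL b\<^esub> h = A'"
    using assoc_mult_mat[OF gA H(2,1)] assoc_mult_mat[OF A(2) H(1,2)] H gA A by simp_all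
  then show ?thesis by metis
qed

lemma intertwine_sym:
  assumes g: "g \<in> carrier (GL a)" and h: "h \<in> carrier (GL b)"
    and A: "A \<in> carrier_mat a b" "A' \<in> carrier_mat a b" and e: "g * A = A' * h"
  shows "inv\<^bsub>GL a\<^esub> g * A' = A * inv\<^bsub>GL b\<^esub> h"
proof -
  note G = GL_D[OF g] and H = GL_D[OF h]
  have "A' = g * A * inv\<^bsub>GL b\<^esub> h" using e conj_eq_iff[OF G(1) h A] by simp
  also have "\<dots> = g * (A * inv\<^bsub>GL b\<^esub> h)" using assoc_mult_mat[OF G(1) A(1) H(2)] .
  finally have "inv\<^bsub>GL a\<^esub> g * A' = (inv\<^bsub>GL a\<^esub> g * g) * (A * inv\<^bsub>GL b\<^esub> h)"
    using assoc_mult_mat[OF G(2,1), of "A * inv\<^bsub>GL b\<^esub> h" b] A H by simp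
  then show ?thesis using G A H by simp
qed

lemma intertwine_trans:
  assumes "g \<in> carrier_mat a a" "g' \<in> carrier_mat a a" "h \<in> carrier_mat b b" "h' \<in> carrier_mat b b"
    and A: "A \<in> carrier_mat a b" "A' \<in> carrier_mat a b" "A'' \<in> carrier_mat a b"
    and e: "g * A = A' * h" "g' * A' = A'' * h'"
  shows "(g' * g) * A = A'' * (h' * h)"
proof -
  have "(g' * g) * A = g' * (A' * h)" using assms by (simp flip: e)
  also have "\<dots> = (A'' * h') * h" using assms(1-4) A by (simp flip: e(2))
  finally show ?thesis using assms(1-4) A by simp
qed

text \<open>For data of the right shapes and invertible \<open>g i\<close> this is
  \<open>gauge_action s n g X = X'\<close> with the inverses cleared. It says that \<open>g\<close>
  is a morphism of quiver representations that is the identity on W.\<close>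

definition intertwines ::
  "nat \<Rightarrow> (nat \<Rightarrow> complex mat) \<Rightarrow> nested_adhm \<Rightarrow> nested_adhm \<Rightarrow> bool" where
  "intertwines s g X X' \<longleftrightarrow>
     (\<forall>i<s. g i * fB1 X i = fB1 X' i * g i \<and> g i * fB2 X i = fB2 X' i * g i) \<and>
     g 0 * fI X = fI X' \<and> fJ X = fJ X' * g 0 \<and>
     (\<forall>i\<in>{1..<s}. g (i - 1) * fF X i = fF X' i * g i \<and> g i * fG X i = fG X' i * g (i - 1))"

text \<open>Only the values of \<open>g\<close> below \<open>s\<close> matter, so \<open>g\<close>
  is not restricted to extensional functions as the elements of \<open>gauge_group\<close>
  are.\<close>

definition gauge_equiv :: "nat \<Rightarrow> (nat \<Rightarrow> nat) \<Rightarrow> nested_adhm \<Rightarrow> nested_adhm \<Rightarrow> bool" where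
  "gauge_equiv s n X X' \<longleftrightarrow> (\<exists>g. (\<forall>i<s. g i \<in> carrier (GL (n i))) \<and> intertwines s g X X')"

lemma gauge_equivI:
  assumes "\<And>i. i < s \<Longrightarrow> g i \<in> carrier (GL (n i))" "intertwines s g X X'"
  shows "gauge_equiv s n X X'"
  using assms unfolding gauge_equiv_def by blast

lemma mapsD:
  assumes "X \<in> nested_adhm_maps r s n"
  shows "i < s \<Longrightarrow> fB1 X i \<in> carrier_mat (n i) (n i)" "i < s \<Longrightarrow> fB2 X i \<in> carrier_mat (n i) (n i)"
    "fI X \<in> carrier_mat (n 0) r" "fJ X \<in> carrier_mat r (n 0)"
    "i \<in> {1..<s} \<Longrightarrow> fF X i \<in> carrier_mat (n (i - 1)) (n i)"
    "i \<in> {1..<s} \<Longrightarrow> fG X i \<in> carrier_mat (n i) (n (i - 1))"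
  using assms unfolding nested_adhm_maps_def by (auto simp: PiE_iff)

lemma maps_ext:
  assumes X: "X \<in> nested_adhm_maps r s n" "Y \<in> nested_adhm_maps r s n"
    and e: "\<And>i. i < s \<Longrightarrow> fB1 X i = fB1 Y i" "\<And>i. i < s \<Longrightarrow> fB2 X i = fB2 Y i"
      "fI X = fI Y" "fJ X = fJ Y"
      "\<And>i. i \<in> {1..<s} \<Longrightarrow> fF X i = fF Y i" "\<And>i. i \<in> {1..<s} \<Longrightarrow> fG X i = fG Y i"
  shows "X = Y"
proof -
  note m = X[unfolded nested_adhm_maps_def mem_Collect_eq]
  have "fB1 X = fB1 Y" 
    by (rule PiE_ext[of _ "{..<s}" "\<lambda>i. carrier_mat (n i) (n i)"]) (simp_all only: m e(1) lessThan_iff)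
  moreover have "fB2 X = fB2 Y" 
    by (rule PiE_ext[of _ "{..<s}" "\<lambda>i. carrier_mat (n i) (n i)"]) (simp_all only: m e(2) lessThan_iff)
  moreover have "fF X = fF Y" 
    by (rule PiE_ext[of _ "{1..<s}" "\<lambda>i. carrier_mat (n (i - 1)) (n i)"]) (simp_all only: m e(5) lessThan_iff)
  moreover have "fG X = fG Y" 
    by (rule PiE_ext[of _ "{1..<s}" "\<lambda>i. carrier_mat (n i) (n (i - 1))"]) (simp_all only: m e(6) lessThan_iff)
  ultimately show ?thesis using e by (intro nested_adhm.equality) auto
qed

lemma gauge_action_maps:
  assumes X: "X \<in> nested_adhm_maps r s n" and s: "0 < s" and g: "\<And>i. i < s \<Longrightarrow> g i \<in> carrier (GL (n i))"
  shows "gauge_action s n g X \<in> nested_adhm_maps r s n"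
proof -
  have g': "g i \<in> carrier_mat (n i) (n i)" "inv\<^bsub>GL (n i)\<^esub> (g i) \<in> carrier_mat (n i) (n i)"
    if "i < s" for i using GL_D[OF g[OF that]] by auto
  have h: "i - 1 < s" if "i \<in> {1..<s}" for i using that by auto
  have *: "g i * A * inv\<^bsub>GL (n j)\<^esub> (g j) \<in> carrier_mat (n i) (n j)"
    if "A \<in> carrier_mat (n i) (n j)" "i < s" "j < s" for A i j
    using that(1) g'(1)[OF that(2)] g'(2)[OF that(3)] by simp
  have "g 0 * fI X \<in> carrier_mat (n 0) r" "fJ X * inv\<^bsub>GL (n 0)\<^esub> (g 0) \<in> carrier_mat r (n 0)"
    using mapsD(3,4)[OF X] g'[OF s] by simp_all
  then show ?thesis unfolding nested_adhm_maps_def gauge_action_def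
    using mapsD[OF X] h by (auto intro!: *)
qed

lemma gauge_action_eq_iff:
  assumes X: "X \<in> nested_adhm_maps r s n" "X' \<in> nested_adhm_maps r s n" and s: "0 < s"
    and g: "\<And>i. i < s \<Longrightarrow> g i \<in> carrier (GL (n i))"
  shows "gauge_action s n g X = X' \<longleftrightarrow> intertwines s g X X'"
proof -
  let ?Y = "gauge_action s n g X"
  note D = mapsD[OF X(1)] and D' = mapsD[OF X(2)]
  have gc: "g i \<in> carrier_mat (n i) (n i)" if "i < s" for i using GL_D[OF g[OF that]] by auto
  have i1: "i - 1 < s" "i < s" if "i \<in> {1..<s}" for i using that by auto
  have a: "fB1 ?Y i = fB1 X' i \<longleftrightarrow> g i * fB1 X i = fB1 X' i * g i"
    "fB2 ?Y i = fB2 X' i \<longleftrightarrow> g i * fB2 X i = fB2 X' i * g i" if "i < s" for i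
    using conj_eq_iff[OF gc g D(1) D'(1)] conj_eq_iff[OF gc g D(2) D'(2)] that
    by (auto simp: gauge_action_def)
  have b: "fF ?Y i = fF X' i \<longleftrightarrow> g (i - 1) * fF X i = fF X' i * g i"
    "fG ?Y i = fG X' i \<longleftrightarrow> g i * fG X i = fG X' i * g (i - 1)" if "i \<in> {1..<s}" for i
    using conj_eq_iff[OF gc[OF i1(1)[OF that]] g[OF i1(2)[OF that]] D(5)[OF that] D'(5)[OF that]]
      conj_eq_iff[OF gc[OF i1(2)[OF that]] g[OF i1(1)[OF that]] D(6)[OF that] D'(6)[OF that]] that
    by (auto simp: gauge_action_def)
  have c: "fJ ?Y = fJ X' \<longleftrightarrow> fJ X = fJ X' * g 0"
    using conj_eq_iff[OF one_carrier_mat g[OF s] D(4) D'(4)] D(4) by (auto simp: gauge_action_def)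
  have d: "fI ?Y = g 0 * fI X" by (simp add: gauge_action_def)
  have "?Y = X' \<longleftrightarrow> (\<forall>i<s. fB1 ?Y i = fB1 X' i \<and> fB2 ?Y i = fB2 X' i) \<and> fI ?Y = fI X' \<and>
    fJ ?Y = fJ X' \<and> (\<forall>i\<in>{1..<s}. fF ?Y i = fF X' i \<and> fG ?Y i = fG X' i)"
    using maps_ext[OF gauge_action_maps[OF X(1) s g] X(2)] by auto
  then show ?thesis unfolding intertwines_def using a b c d by auto
qed

text \<open>From here on orbits are handled as classes of the relation \<open>gauge_equiv\<close>,
  whose three equivalence laws follow.\<close>

lemma gauge_orbit_eq:
  assumes X: "X \<in> nested_adhm_maps r s n" and s: "0 < s"
  shows "orbit (gauge_group s n) (gauge_action s n) X
    = {X' \<in> nested_adhm_maps r s n. gauge_equiv s n X X'}" (is "?O = ?E")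
proof (intro equalityI subsetI)
  fix X' assume "X' \<in> ?O"
  then obtain g where g: "\<And>i. i < s \<Longrightarrow> g i \<in> carrier (GL (n i))" and e: "gauge_action s n g X = X'"
    unfolding orbit_def gauge_group_def by auto
  have "X' \<in> nested_adhm_maps r s n" using gauge_action_maps[OF X s g] e by simp
  then show "X' \<in> ?E" using gauge_action_eq_iff[OF X _ s g] e g unfolding gauge_equiv_def by auto
next
  fix X' assume "X' \<in> ?E"
  then obtain g where X': "X' \<in> nested_adhm_maps r s n"
    and g: "\<And>i. i < s \<Longrightarrow> g i \<in> carrier (GL (n i))" and i: "intertwines s g X X'"
    unfolding gauge_equiv_def by auto
  \<comment> \<open>The carrier of a product group consists of extensional functions.\<close>
  let ?g = "restrict g {..<s}"
  have "intertwines s ?g X X'" using i s unfolding intertwines_def by auto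
  then have "gauge_action s n ?g X = X'" using gauge_action_eq_iff[OF X X' s, of ?g] g by auto
  moreover have "?g \<in> carrier (gauge_group s n)" using g by (auto simp: gauge_group_def)
  ultimately show "X' \<in> ?O" unfolding orbit_def by blast
qed

lemma gauge_equiv_refl:
  assumes X: "X \<in> nested_adhm_maps r s n"
  shows "gauge_equiv s n X X"
proof -
  have "1\<^sub>m (n i) \<in> carrier (GL (n i))" for i by (rule GL_I(1)[where h="1\<^sub>m (n i)"]) auto
  moreover have "intertwines s (\<lambda>i. 1\<^sub>m (n i)) X X"
    unfolding intertwines_def
    by (simp add: left_mult_one_mat[OF mapsD(1)[OF X]] right_mult_one_mat[OF mapsD(1)[OF X]]
        left_mult_one_mat[OF mapsD(2)[OF X]] right_mult_one_mat[OF mapsD(2)[OF X]]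
        left_mult_one_mat[OF mapsD(3)[OF X]] right_mult_one_mat[OF mapsD(4)[OF X]]
        left_mult_one_mat[OF mapsD(5)[OF X], simplified] right_mult_one_mat[OF mapsD(5)[OF X], simplified]
        left_mult_one_mat[OF mapsD(6)[OF X], simplified] right_mult_one_mat[OF mapsD(6)[OF X], simplified])
  ultimately show ?thesis
    unfolding gauge_equiv_def by (intro exI[of _ "\<lambda>i. 1\<^sub>m (n i)"]) simp
qed

lemma gauge_equiv_sym:
  assumes X: "X \<in> nested_adhm_maps r s n" "X' \<in> nested_adhm_maps r s n" and s: "0 < s"
    and e: "gauge_equiv s n X X'"
  shows "gauge_equiv s n X' X"
proof -
  obtain g where g: "\<And>i. i < s \<Longrightarrow> g i \<in> carrier (GL (n i))" and i: "intertwines s g X X'"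
    using e unfolding gauge_equiv_def by auto
  note D = mapsD[OF X(1)] and D' = mapsD[OF X(2)]
  note I = i[unfolded intertwines_def]
  note G0 = GL_D[OF g[OF s]]
  have i1: "i - 1 < s" "i < s" if "i \<in> {1..<s}" for i using that by auto
  let ?h = "\<lambda>i. inv\<^bsub>GL (n i)\<^esub> (g i)"
  have 1: "?h i * fB1 X' i = fB1 X i * ?h i" if "i < s" for i
    using intertwine_sym[OF g g D(1) D'(1)] that I by simp
  have 2: "?h i * fB2 X' i = fB2 X i * ?h i" if "i < s" for i
    using intertwine_sym[OF g g D(2) D'(2)] that I by simp
  have 3: "?h (i - 1) * fF X' i = fF X i * ?h i" if "i \<in> {1..<s}" for i
    using intertwine_sym[OF g[OF i1(1)[OF that]] g[OF i1(2)[OF that]] D(5)[OF that] D'(5)[OF that]] that I by blast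
  have 4: "?h i * fG X' i = fG X i * ?h (i - 1)" if "i \<in> {1..<s}" for i
    using intertwine_sym[OF g[OF i1(2)[OF that]] g[OF i1(1)[OF that]] D(6)[OF that] D'(6)[OF that]] that I by blast
  have "fI X' = g 0 * fI X" "fJ X = fJ X' * g 0" using I by auto
  then have 5: "?h 0 * fI X' = fI X" "fJ X' = fJ X * ?h 0"
    using G0 D D' assoc_mult_mat[OF G0(2,1) D(3)] assoc_mult_mat[OF D'(4) G0(1,2)] by auto
  have "intertwines s ?h X' X" unfolding intertwines_def using 1 2 3 4 5 by blast
  then show ?thesis
  proof (rule gauge_equivI[rotated])
    show "?h i \<in> carrier (GL (n i))" if "i < s" for i using GL_D[OF g[OF that]] by auto
  qed
qed

lemma gauge_equiv_trans:
  assumes X: "X \<in> nested_adhm_maps r s n" "X' \<in> nested_adhm_maps r s n" "X'' \<in> nested_adhm_maps r s n"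
    and s: "0 < s" and e: "gauge_equiv s n X X'" "gauge_equiv s n X' X''"
  shows "gauge_equiv s n X X''"
proof -
  obtain g where g: "\<And>i. i < s \<Longrightarrow> g i \<in> carrier (GL (n i))" and i: "intertwines s g X X'"
    using e unfolding gauge_equiv_def by auto
  obtain h where h: "\<And>i. i < s \<Longrightarrow> h i \<in> carrier (GL (n i))" and j: "intertwines s h X' X''"
    using e unfolding gauge_equiv_def by auto
  note D = mapsD[OF X(1)] and D' = mapsD[OF X(2)] and D'' = mapsD[OF X(3)]
  note I = i[unfolded intertwines_def] and J = j[unfolded intertwines_def]
  note gc = GL_D(1)[OF g] and hc = GL_D(1)[OF h]
  have i1: "i - 1 < s" "i < s" if "i \<in> {1..<s}" for i using that by auto
  let ?k = "\<lambda>i. h i * g i"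
  have 1: "?k i * fB1 X i = fB1 X'' i * ?k i" if "i < s" for i
    using intertwine_trans[OF gc hc gc hc D(1) D'(1) D''(1)] that I J by simp
  have 2: "?k i * fB2 X i = fB2 X'' i * ?k i" if "i < s" for i
    using intertwine_trans[OF gc hc gc hc D(2) D'(2) D''(2)] that I J by simp
  have 3: "?k (i - 1) * fF X i = fF X'' i * ?k i" if "i \<in> {1..<s}" for i
    using intertwine_trans[OF gc[OF i1(1)[OF that]] hc[OF i1(1)[OF that]] gc[OF i1(2)[OF that]] hc[OF i1(2)[OF that]]
      D(5)[OF that] D'(5)[OF that] D''(5)[OF that]] that I J by blast
  have 4: "?k i * fG X i = fG X'' i * ?k (i - 1)" if "i \<in> {1..<s}" for i
    using intertwine_trans[OF gc[OF i1(2)[OF that]] hc[OF i1(2)[OF that]] gc[OF i1(1)[OF that]] hc[OF i1(1)[OF that]]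
      D(6)[OF that] D'(6)[OF that] D''(6)[OF that]] that I J by blast
  have e5: "fI X' = g 0 * fI X" "fI X'' = h 0 * fI X'" "fJ X = fJ X' * g 0" "fJ X' = fJ X'' * h 0" using I J by auto
  have 5: "?k 0 * fI X = fI X''" "fJ X = fJ X'' * ?k 0"
    using e5 assoc_mult_mat[OF hc gc D(3)] assoc_mult_mat[OF D''(4) hc gc] s by auto
  have "intertwines s ?k X X''" unfolding intertwines_def using 1 2 3 4 5 by blast
  then show ?thesis
  proof (rule gauge_equivI[rotated])
    show "?k i \<in> carrier (GL (n i))" if "i < s" for i using GL_mult g h that by auto
  qed
qed

section \<open>Torus action on gauge orbits\<close>

lemma torus_action_maps:
  assumes X: "X \<in> nested_adhm_maps r s n"
  shows "torus_action r s t X \<in> nested_adhm_maps r s n"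
proof -
  obtain t1 t2 \<rho> where "t = (t1, t2, \<rho>)" by (cases t)
  moreover have "fI X * mat_diag r (\<lambda>a. inverse (\<rho> a)) \<in> carrier_mat (n 0) r"
    "mat_diag r \<rho> * fJ X \<in> carrier_mat r (n 0)"
    using mult_carrier_mat[OF mapsD(3)[OF X] mat_diag_dim] mult_carrier_mat[OF mat_diag_dim mapsD(4)[OF X]]
    by auto
  ultimately show ?thesis using X mapsD(1,2)[OF X] unfolding nested_adhm_maps_def by auto
qed

text \<open>The same \<open>g\<close> serves both pairs: scalars commute with every
  \<open>g i\<close>, and the diagonal matrices act on the W side of I and J, where \<open>g\<close>
  does nothing.\<close>

lemma torus_action_equiv:
  assumes X: "X \<in> nested_adhm_maps r s n" "X' \<in> nested_adhm_maps r s n" and s: "0 < s"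
    and e: "gauge_equiv s n X X'"
  shows "gauge_equiv s n (torus_action r s t X) (torus_action r s t X')"
proof -
  obtain t1 t2 \<rho> where t: "t = (t1, t2, \<rho>)" by (cases t)
  obtain g where g: "\<And>i. i < s \<Longrightarrow> g i \<in> carrier (GL (n i))" and i: "intertwines s g X X'"
    using e unfolding gauge_equiv_def by auto
  note D = mapsD[OF X(1)] and D' = mapsD[OF X(2)] and gc = GL_D(1)[OF g]
  note I = i[unfolded intertwines_def]
  have 1: "g i * (c \<cdot>\<^sub>m fB1 X i) = (c \<cdot>\<^sub>m fB1 X' i) * g i"
     "g i * (c \<cdot>\<^sub>m fB2 X i) = (c \<cdot>\<^sub>m fB2 X' i) * g i" if "i < s" for i c
    using mult_smult_distrib[OF gc D(1)] mult_smult_assoc_mat[OF D'(1) gc]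
      mult_smult_distrib[OF gc D(2)] mult_smult_assoc_mat[OF D'(2) gc] that I by auto
  have 2: "g 0 * (fI X * mat_diag r f) = fI X' * mat_diag r f" for f
    using assoc_mult_mat[OF gc D(3) mat_diag_dim] s I by metis
  have m: "mat_diag r f * fJ X' \<in> carrier_mat r (n 0)" for f
    using mult_carrier_mat[OF mat_diag_dim D'(4)] .
  have 3: "c \<cdot>\<^sub>m (mat_diag r f * fJ X) = (c \<cdot>\<^sub>m (mat_diag r f * fJ X')) * g 0" for f c
    using assoc_mult_mat[OF mat_diag_dim D'(4) gc[OF s]] mult_smult_assoc_mat[OF m gc[OF s]] I by auto
  have "intertwines s g (torus_action r s t X) (torus_action r s t X')"
    unfolding intertwines_def t using 1 2 3 I s by auto
  then show ?thesis using g by (rule gauge_equivI[rotated])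
qed

text \<open>Every datum is the image under \<open>t\<close> of another one; this upgrades invariance
  of an orbit under the torus to equality with its image.\<close>

lemma torus_action_inverse:
  assumes X: "X \<in> nested_adhm_maps r s n" and t: "(t1, t2, \<rho>) \<in> torus r"
  defines "t' \<equiv> (inverse t1, inverse t2, \<lambda>a\<in>{..<r}. inverse (\<rho> a))"
  shows "t' \<in> torus r" "torus_action r s (t1, t2, \<rho>) (torus_action r s t' X) = X"
proof -
  note D = mapsD[OF X]
  have nz: "t1 \<noteq> 0" "t2 \<noteq> 0" "\<And>a. a < r \<Longrightarrow> \<rho> a \<noteq> 0" using t unfolding torus_def by auto
  then show "t' \<in> torus r" unfolding torus_def t'_def by auto
  have m: "mat_diag r f * fJ X \<in> carrier_mat r (n 0)" for f
    using mult_carrier_mat[OF mat_diag_dim D(4)] .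
  have s1: "c \<cdot>\<^sub>m (inverse c \<cdot>\<^sub>m A) = A" if "c \<noteq> 0" for c :: complex and A
    using that by (intro eq_matI) (auto simp: field_simps)
  \<comment> \<open>Only indices below \<open>r\<close> are tested, so the value of the restricted
    inverse outside \<open>{..<r}\<close> is harmless.\<close>
  have d: "mat_diag r (\<lambda>a. f a * h a) = 1\<^sub>m r" if "\<And>a. a < r \<Longrightarrow> f a * h a = 1" for f h :: "nat \<Rightarrow> complex"
    using that by (intro eq_matI) (auto simp: mat_diag_def)
  show "torus_action r s (t1, t2, \<rho>) (torus_action r s t' X) = X"
  proof (rule maps_ext[OF torus_action_maps[OF torus_action_maps[OF X]] X])
    show "fI (torus_action r s (t1, t2, \<rho>) (torus_action r s t' X)) = fI X"
      using assoc_mult_mat[OF D(3) mat_diag_dim mat_diag_dim] D(3) d nz by (simp add: t'_def)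
    have "(t1 * t2) \<cdot>\<^sub>m (mat_diag r \<rho> * ((inverse t1 * inverse t2) \<cdot>\<^sub>m (mat_diag r (\<lambda>a\<in>{..<r}. inverse (\<rho> a)) * fJ X)))
      = (t1 * t2) \<cdot>\<^sub>m ((inverse (t1 * t2)) \<cdot>\<^sub>m (mat_diag r \<rho> * (mat_diag r (\<lambda>a\<in>{..<r}. inverse (\<rho> a)) * fJ X)))"
      using mult_smult_distrib[OF mat_diag_dim m] by simp
    also have "\<dots> = (mat_diag r \<rho> * mat_diag r (\<lambda>a\<in>{..<r}. inverse (\<rho> a))) * fJ X"
      using s1[of "t1 * t2"] nz by (subst assoc_mult_mat[OF mat_diag_dim mat_diag_dim D(4)]) simp
    also have "\<dots> = fJ X" using d nz D(4) by simp
    finally show "fJ (torus_action r s (t1, t2, \<rho>) (torus_action r s t' X)) = fJ X"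
      by (simp add: t'_def)
  qed (use s1 nz in \<open>auto simp: t'_def\<close>)
qed

text \<open>One representative decides: for \<open>Y\<close> in the orbit of \<open>X\<close>,
  \<open>t Y\<close> is equivalent to \<open>t X\<close> and hence to \<open>X\<close>. Both sides
  quantify over all \<open>t\<close> because the reverse inclusion applies the hypothesis to the
  inverse of \<open>t\<close>.\<close>

lemma torus_fixed_orbit_iff:
  assumes X: "X \<in> nested_adhm_maps r s n" and s: "0 < s"
  defines "\<O> \<equiv> {X' \<in> nested_adhm_maps r s n. gauge_equiv s n X X'}"
  shows "(\<forall>t\<in>torus r. torus_action r s t ` \<O> = \<O>) \<longleftrightarrow>
    (\<forall>t\<in>torus r. gauge_equiv s n X (torus_action r s t X))"
proof (intro iffI ballI)
  fix t assume h: "\<forall>t\<in>torus r. torus_action r s t ` \<O> = \<O>" and t: "t \<in> torus r"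
  have "X \<in> \<O>" using X gauge_equiv_refl by (auto simp: \<O>_def)
  then have "torus_action r s t X \<in> \<O>" using h t by blast
  then show "gauge_equiv s n X (torus_action r s t X)" by (auto simp: \<O>_def)
next
  fix t assume h: "\<forall>t\<in>torus r. gauge_equiv s n X (torus_action r s t X)" and t: "t \<in> torus r"
  have *: "torus_action r s t Y \<in> \<O>" if "t \<in> torus r" "Y \<in> \<O>" for t Y
    using that h X s torus_action_maps[of _ r s n] torus_action_equiv[of X r s n Y t]
      gauge_equiv_trans[of X r s n "torus_action r s t X" "torus_action r s t Y"]
    unfolding \<O>_def by blast
  obtain t1 t2 \<rho> where tt: "t = (t1, t2, \<rho>)" by (cases t)
  show "torus_action r s t ` \<O> = \<O>"
  proof (intro equalityI subsetI)
    fix Y assume Y: "Y \<in> \<O>"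
    let ?t = "(inverse t1, inverse t2, \<lambda>a\<in>{..<r}. inverse (\<rho> a))"
    note i = torus_action_inverse[of Y r s n t1 t2 \<rho>]
    have "Y = torus_action r s t (torus_action r s ?t Y)" "?t \<in> torus r"
      using i Y t tt by (auto simp: \<O>_def)
    then show "Y \<in> torus_action r s t ` \<O>" using *[OF _ Y] by blast
  qed (use *[OF t] in blast)
qed

section \<open>Shift matrices attached to flags of boxes\<close>

type_synonym box = "nat \<times> nat \<times> nat"

fun shift1 :: "box \<Rightarrow> box" where "shift1 (a, i, j) = (a, Suc i, j)"
fun shift2 :: "box \<Rightarrow> box" where "shift2 (a, i, j) = (a, i, Suc j)"

text \<open>In bases labelled by \<open>e\<close> and \<open>e'\<close> this is the linear map
  sending the basis vector of \<open>p\<close> to that of \<open>\<sigma> p\<close>, or to 0 when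
  \<open>\<sigma> p\<close> is no row label. The label types are free so that I, whose columns are
  labelled by colours, is an instance.\<close>

definition incidence_mat ::
  "nat \<Rightarrow> (nat \<Rightarrow> 'b) \<Rightarrow> ('a \<Rightarrow> 'b) \<Rightarrow> nat \<Rightarrow> (nat \<Rightarrow> 'a) \<Rightarrow> complex mat" where
  "incidence_mat m e' \<sigma> k e = mat m k (\<lambda>(i, j). if e' i = \<sigma> (e j) then 1 else 0)"

text \<open>For injective \<open>e\<close> this is the basis vector labelled \<open>p\<close>, and 0
  when \<open>p\<close> is no label. The second case lets a monomial outside the diagram be treated
  like the others.\<close>

definition indicator_vec :: "nat \<Rightarrow> (nat \<Rightarrow> 'b) \<Rightarrow> 'b \<Rightarrow> complex vec" where
  "indicator_vec m e p = vec m (\<lambda>i. if e i = p then 1 else 0)"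

lemma incidence_mat_carrier [simp]: "incidence_mat m e' \<sigma> k e \<in> carrier_mat m k"
  by (simp add: incidence_mat_def)

lemma indicator_vec_carrier [simp]: "indicator_vec m e p \<in> carrier_vec m"
  by (simp add: indicator_vec_def)

lemma sum_indicator:
  fixes f :: "nat \<Rightarrow> complex"
  assumes "inj_on e {..<m}" "h < m"
  shows "(\<Sum>i = 0..<m. f i * (if e i = e h then 1 else 0)) = f h"
proof -
  have "(\<Sum>i = 0..<m. f i * (if e i = e h then 1 else 0)) = (\<Sum>i = 0..<m. if i = h then f i else 0)"
    using assms by (intro sum.cong) (auto simp: inj_on_def)
  also have "\<dots> = f h" using assms by simp
  finally show ?thesis .
qed

text \<open>If \<open>p\<close> is no column label the left side is 0, so \<open>\<sigma> p\<close>
  must then be no row label either.\<close>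

lemma incidence_mat_mult_indicator:
  assumes "inj_on e {..<k}" and "p \<in> e ` {..<k} \<or> \<sigma> p \<notin> e' ` {..<m}"
  shows "incidence_mat m e' \<sigma> k e *\<^sub>v indicator_vec k e p = indicator_vec m e' (\<sigma> p)"
proof (rule eq_vecI)
  fix i assume "i < dim_vec (indicator_vec m e' (\<sigma> p))"
  then have i: "i < m" by (simp add: indicator_vec_def)
  have *: "(incidence_mat m e' \<sigma> k e *\<^sub>v indicator_vec k e p) $ i
    = (\<Sum>h = 0..<k. (if e' i = \<sigma> (e h) then 1 else 0) * (if e h = p then 1 else 0))"
    using i by (simp add: incidence_mat_def indicator_vec_def scalar_prod_def)
  show "(incidence_mat m e' \<sigma> k e *\<^sub>v indicator_vec k e p) $ i = indicator_vec m e' (\<sigma> p) $ i"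
  proof (cases "p \<in> e ` {..<k}")
    case True
    then obtain h where "h < k" "p = e h" by auto
    then show ?thesis unfolding * using sum_indicator[OF assms(1)] i by (simp add: indicator_vec_def)
  next
    case False
    then have "(\<Sum>h = 0..<k. (if e' i = \<sigma> (e h) then 1 else 0) * (if e h = p then 1 else 0)) = (0::complex)"
      by (intro sum.neutral) auto
    moreover have "e' i \<noteq> \<sigma> p" using False assms(2) i by (metis imageI lessThan_iff)
    ultimately show ?thesis unfolding * using i by (simp add: indicator_vec_def)
  qed
qed (simp add: incidence_mat_def indicator_vec_def)

lemma col_incidence_mat: "j < k \<Longrightarrow> col (incidence_mat m e' \<sigma> k e) j = indicator_vec m e' (\<sigma> (e j))"
  by (rule eq_vecI) (auto simp: incidence_mat_def indicator_vec_def)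

text \<open>The hypothesis excludes a path that leaves the middle index set and comes back: there
  the product would have 0 where the composite shift has 1.\<close>

lemma incidence_mat_mult:
  assumes inj: "inj_on e' {..<m}"
    and h: "\<And>j. j < k \<Longrightarrow> \<tau> (\<sigma> (e j)) \<in> e'' ` {..<l} \<Longrightarrow> \<sigma> (e j) \<in> e' ` {..<m}"
  shows "incidence_mat l e'' \<tau> m e' * incidence_mat m e' \<sigma> k e = incidence_mat l e'' (\<tau> \<circ> \<sigma>) k e"
proof (rule mat_col_eqI)
  fix j assume "j < dim_col (incidence_mat l e'' (\<tau> \<circ> \<sigma>) k e)"
  then have j: "j < k" by (simp add: incidence_mat_def)
  have "col (incidence_mat l e'' \<tau> m e' * incidence_mat m e' \<sigma> k e) j
    = incidence_mat l e'' \<tau> m e' *\<^sub>v indicator_vec m e' (\<sigma> (e j))"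
    using j by (subst col_mult2[of _ l m _ k]) (simp_all add: col_incidence_mat)
  also have "\<dots> = indicator_vec l e'' (\<tau> (\<sigma> (e j)))"
    using h[OF j] by (intro incidence_mat_mult_indicator inj) blast
  finally show "col (incidence_mat l e'' \<tau> m e' * incidence_mat m e' \<sigma> k e) j
    = col (incidence_mat l e'' (\<tau> \<circ> \<sigma>) k e) j" using j by (simp add: col_incidence_mat)
qed (simp_all add: incidence_mat_def)

lemma incidence_mat_id: "inj_on e {..<m} \<Longrightarrow> incidence_mat m e id m e = 1\<^sub>m m"
  by (rule eq_matI) (auto simp: incidence_mat_def inj_on_def)

text \<open>Rescaling the bases by weights multiplies a shift by the ratio \<open>c\<close> of the
  weights. This is how a torus element is realised by a diagonal gauge transformation.\<close>

lemma mat_diag_incidence_mat: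
  assumes "\<And>j. j < k \<Longrightarrow> f (\<sigma> (e j)) = c * f' j"
  shows "mat_diag m (\<lambda>i. f (e' i)) * incidence_mat m e' \<sigma> k e
    = c \<cdot>\<^sub>m (incidence_mat m e' \<sigma> k e * mat_diag k f')"
proof -
  show ?thesis
    unfolding mat_diag_mult_left[OF incidence_mat_carrier] mat_diag_mult_right[OF incidence_mat_carrier]
    using assms by (intro eq_matI) (auto simp: incidence_mat_def)
qed

text \<open>\<open>E k\<close> stands for the boxes whose monomials span the image of \<open>V\<^sub>k\<close> in \<open>V\<^sub>0\<close>, so that
  \<open>E 0 - E k\<close> is the diagram of the coloured partition \<open>\<mu>\<^sub>k\<close> for \<open>k \<ge> 1\<close>.\<close>

definition is_flag :: "nat \<Rightarrow> nat \<Rightarrow> (nat \<Rightarrow> nat) \<Rightarrow> (nat \<Rightarrow> box set) \<Rightarrow> bool" where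
  "is_flag r s n E \<longleftrightarrow>
     E 0 \<subseteq> {..<r} \<times> UNIV \<and>
     (\<forall>p. (shift1 p \<in> E 0 \<longrightarrow> p \<in> E 0) \<and> (shift2 p \<in> E 0 \<longrightarrow> p \<in> E 0)) \<and>
     (\<forall>k\<in>{1..<s}. E k \<subseteq> E (k - 1)) \<and>
     (\<forall>k<s. \<forall>p\<in>E k. (shift1 p \<in> E 0 \<longrightarrow> shift1 p \<in> E k) \<and> (shift2 p \<in> E 0 \<longrightarrow> shift2 p \<in> E k)) \<and>
     (\<forall>k<s. finite (E k) \<and> card (E k) = n k)"

text \<open>Monomial model: \<open>e k\<close> labels the basis of V_k by boxes, \<open>B_1\<close>
  and \<open>B_2\<close> multiply by x and y and kill whatever leaves the set of boxes, and each F
  is an inclusion.\<close>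

definition shift_datum :: "nat \<Rightarrow> nat \<Rightarrow> (nat \<Rightarrow> nat) \<Rightarrow> (nat \<Rightarrow> nat \<Rightarrow> box) \<Rightarrow> nested_adhm" where
  "shift_datum r s n e = \<lparr>
     fB1 = (\<lambda>k\<in>{..<s}. incidence_mat (n k) (e k) shift1 (n k) (e k)),
     fB2 = (\<lambda>k\<in>{..<s}. incidence_mat (n k) (e k) shift2 (n k) (e k)),
     fI = incidence_mat (n 0) (e 0) (\<lambda>a. (a, 0, 0)) r id,
     fJ = 0\<^sub>m r (n 0),
     fF = (\<lambda>k\<in>{1..<s}. incidence_mat (n (k - 1)) (e (k - 1)) id (n k) (e k)),
     fG = (\<lambda>k\<in>{1..<s}. 0\<^sub>m (n k) (n (k - 1)))\<rparr>"

primrec F_chain :: "(nat \<Rightarrow> nat) \<Rightarrow> nested_adhm \<Rightarrow> nat \<Rightarrow> complex mat" where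
  "F_chain n X 0 = 1\<^sub>m (n 0)"
| "F_chain n X (Suc k) = F_chain n X k * fF X (Suc k)"

text \<open>The image of \<open>x\<^sup>i y\<^sup>j \<otimes> w\<^sub>a\<close> in \<open>V\<^sub>0\<close>.\<close>

fun box_vec :: "nested_adhm \<Rightarrow> box \<Rightarrow> complex vec" where
  "box_vec X (a, i, j) = ((\<lambda>v. fB1 X 0 *\<^sub>v v) ^^ i) (((\<lambda>v. fB2 X 0 *\<^sub>v v) ^^ j) (col (fI X) a))"

text \<open>A gauge invariant that reads the boxes of V_k off an arbitrary datum. On a shift datum
  it returns the flag and so separates orbits; on a fixed datum it supplies the flag of the normal
  form.\<close>

definition box_support :: "nat \<Rightarrow> (nat \<Rightarrow> nat) \<Rightarrow> nested_adhm \<Rightarrow> nat \<Rightarrow> box set" where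
  "box_support r n X k = {p. fst p < r \<and> box_vec X p \<noteq> 0\<^sub>v (n 0) \<and>
     (\<exists>u\<in>carrier_vec (n k). box_vec X p = F_chain n X k *\<^sub>v u)}"

text \<open>The rule for \<open>fB2\<close> covers exponent 0 of \<open>fB1\<close> only: otherwise
  \<open>fB2\<close> would have to move past \<open>fB1\<close>, which needs commutation and comes
  later as \<open>box_vec_shift2\<close>.\<close>

lemma box_vec_simps:
  "box_vec X (a, 0, 0) = col (fI X) a" "box_vec X (shift1 p) = fB1 X 0 *\<^sub>v box_vec X p"
  "box_vec X (a, 0, Suc j) = fB2 X 0 *\<^sub>v box_vec X (a, 0, j)"
  by (cases p; simp)+

lemma box_vec_carrier:
  assumes X: "X \<in> nested_adhm_maps r s n" and s: "0 < s" and a: "fst p < r"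
  shows "box_vec X p \<in> carrier_vec (n 0)"
proof -
  note D = mapsD[OF X]
  obtain a i j where p: "p = (a, i, j)" by (cases p)
  have "((\<lambda>v. fB2 X 0 *\<^sub>v v) ^^ j) (col (fI X) a) \<in> carrier_vec (n 0)"
  proof (induction j)
    case 0
    then show ?case using D(3) a p by auto
  qed (simp add: mult_mat_vec_carrier[OF D(2)[OF s]])
  then show ?thesis unfolding p box_vec.simps
    by (induction i) (simp_all add: mult_mat_vec_carrier[OF D(1)[OF s]])
qed

lemma F_chain_carrier:
  assumes X: "X \<in> nested_adhm_maps r s n" and s: "k < s"
  shows "F_chain n X k \<in> carrier_mat (n 0) (n k)"
  using s
proof (induction k)
  case (Suc k)
  then show ?case using mult_carrier_mat[OF _ mapsD(5)[OF X, of "Suc k"]] by auto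
qed simp

lemma mat_mult_unit_vec:
  "A \<in> carrier_mat m k \<Longrightarrow> j < k \<Longrightarrow> A *\<^sub>v unit_vec k j = col A j"
  for A :: "complex mat"
  by (intro eq_vecI) auto

lemma GL_mult_vec_eq_0:
  assumes g: "g \<in> carrier (GL m)" and v: "v \<in> carrier_vec m" and "g *\<^sub>v v = 0\<^sub>v m"
  shows "v = 0\<^sub>v m"
proof -
  note G = GL_D[OF g]
  have "v = (inv\<^bsub>GL m\<^esub> g * g) *\<^sub>v v" using G v by simp
  also have "\<dots> = inv\<^bsub>GL m\<^esub> g *\<^sub>v 0\<^sub>v m" using assms(3) by (simp only: assoc_mult_mat_vec[OF G(2,1) v])
  also have "\<dots> = 0\<^sub>v m" using G by (intro eq_vecI) auto
  finally show ?thesis .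
qed

text \<open>Since \<open>g\<close> is the identity on W, \<open>g 0\<close> maps columns of I to
  columns of I, and the relations for \<open>B_1\<close> and \<open>B_2\<close> carry this to all
  words.\<close>

lemma box_vec_intertwines:
  assumes X: "X \<in> nested_adhm_maps r s n" "X' \<in> nested_adhm_maps r s n" and s: "0 < s"
    and g: "g 0 \<in> carrier_mat (n 0) (n 0)" and i: "intertwines s g X X'" and a: "fst p < r"
  shows "box_vec X' p = g 0 *\<^sub>v box_vec X p"
proof -
  note D = mapsD[OF X(1)] and D' = mapsD[OF X(2)] and I = i[unfolded intertwines_def]
  have step: "A' *\<^sub>v (g 0 *\<^sub>v v) = g 0 *\<^sub>v (A *\<^sub>v v)"
    if "v \<in> carrier_vec (n 0)" "A \<in> carrier_mat (n 0) (n 0)" "A' \<in> carrier_mat (n 0) (n 0)" "g 0 * A = A' * g 0" for A A' v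
    using that g by (metis assoc_mult_mat_vec)
  obtain a i j where p: "p = (a, i, j)" by (cases p)
  have ar: "a < r" using assms p by simp
  have "box_vec X' (a, 0, j) = g 0 *\<^sub>v box_vec X (a, 0, j)"
  proof (induction j)
    case 0
    have "fI X' = g 0 * fI X" using I by simp
    then show ?case using col_mult2[OF g D(3) ar] by simp
  next
    case (Suc j)
    show ?case unfolding box_vec_simps Suc
      by (rule step) (use box_vec_carrier[OF X(1) s, of "(a, 0, j)"] D(2)[OF s] D'(2)[OF s] ar s I in simp_all)
  qed
  then have "box_vec X' (a, i, j) = g 0 *\<^sub>v box_vec X (a, i, j)"
  proof (induction i)
    case (Suc i)
    have *: "(a, Suc i, j) = shift1 (a, i, j)" by simp
    show ?case unfolding * box_vec_simps Suc.IH[OF Suc.prems]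
      by (rule step) (use box_vec_carrier[OF X(1) s, of "(a, i, j)"] D(1)[OF s] D'(1)[OF s] ar s I in simp_all)
  qed
  then show ?thesis using p by simp
qed

lemma F_chain_intertwines:
  assumes X: "X \<in> nested_adhm_maps r s n" "X' \<in> nested_adhm_maps r s n" and k: "k < s"
    and g: "\<And>i. i < s \<Longrightarrow> g i \<in> carrier_mat (n i) (n i)" and i: "intertwines s g X X'"
  shows "g 0 * F_chain n X k = F_chain n X' k * g k"
  using k
proof (induction k)
  case 0
  then show ?case using g[of 0] by simp
next
  case (Suc k)
  have k: "k < s" "0 < s" "Suc k \<in> {1..<s}" using Suc.prems by auto
  note D = mapsD(5)[OF X(1) k(3), simplified] and D' = mapsD(5)[OF X(2) k(3), simplified]
  note c = F_chain_carrier[OF X(1) k(1)] F_chain_carrier[OF X(2) k(1)]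
  have "g 0 * F_chain n X (Suc k) = (g 0 * F_chain n X k) * fF X (Suc k)"
    using assoc_mult_mat[OF g[OF k(2)] c(1) D] k by simp
  also have "\<dots> = F_chain n X' k * (g k * fF X (Suc k))"
    by (simp only: Suc.IH[OF k(1)] assoc_mult_mat[OF c(2) g[OF k(1)] D])
  also have "g k * fF X (Suc k) = fF X' (Suc k) * g (Suc k)"
    using i[unfolded intertwines_def, THEN conjunct2, THEN conjunct2, THEN conjunct2, THEN bspec, OF k(3)]
    by simp
  also have "F_chain n X' k * \<dots> = F_chain n X' (Suc k) * g (Suc k)"
    using assoc_mult_mat[OF c(2) D' g[OF Suc.prems]] k by simp
  finally show ?case .
qed

text \<open>Both conditions are transported: \<open>g 0\<close> is injective, and a preimage
  \<open>u\<close> in V_k goes to \<open>g k *\<^sub>v u\<close>.\<close>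

lemma box_support_mono:
  assumes X: "X \<in> nested_adhm_maps r s n" "X' \<in> nested_adhm_maps r s n" and k: "k < s"
    and e: "gauge_equiv s n X X'"
  shows "box_support r n X k \<subseteq> box_support r n X' k"
proof
  fix p assume p: "p \<in> box_support r n X k"
  obtain g where g: "\<And>i. i < s \<Longrightarrow> g i \<in> carrier (GL (n i))" and i: "intertwines s g X X'"
    using e unfolding gauge_equiv_def by auto
  have s: "0 < s" using k by simp
  note gc = GL_D(1)[OF g]
  obtain u where u: "u \<in> carrier_vec (n k)" "box_vec X p = F_chain n X k *\<^sub>v u" and pr: "fst p < r"
    and nz: "box_vec X p \<noteq> 0\<^sub>v (n 0)"
    using p unfolding box_support_def by auto
  note v = box_vec_intertwines[OF X s gc[OF s] i pr]
  have "box_vec X' p \<noteq> 0\<^sub>v (n 0)"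
    using nz v GL_mult_vec_eq_0[OF g[OF s] box_vec_carrier[OF X(1) s pr]] by auto
  moreover have "box_vec X' p = (g 0 * F_chain n X k) *\<^sub>v u"
    using v u assoc_mult_mat_vec[OF gc[OF s] F_chain_carrier[OF X(1) k] u(1)] by simp
  then have "box_vec X' p = F_chain n X' k *\<^sub>v (g k *\<^sub>v u)"
    using assoc_mult_mat_vec[OF F_chain_carrier[OF X(2) k] gc[OF k] u(1)]
      F_chain_intertwines[OF X k gc i] by simp
  moreover have "g k *\<^sub>v u \<in> carrier_vec (n k)" using gc[OF k] u by simp
  ultimately show "p \<in> box_support r n X' k" using pr unfolding box_support_def by blast
qed

lemma box_support_cong:
  assumes X: "X \<in> nested_adhm_maps r s n" "X' \<in> nested_adhm_maps r s n" and k: "k < s"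
    and e: "gauge_equiv s n X X'"
  shows "box_support r n X k = box_support r n X' k"
  using box_support_mono[OF X k e] box_support_mono[OF X(2,1) k gauge_equiv_sym[OF X _ e]] k by auto

section \<open>Subspaces of coordinate spaces\<close>

lemma subspaceD:
  assumes "VectorSpace.subspace class_ring S (module_vec TYPE(complex) m)"
  shows "S \<subseteq> carrier_vec m" "0\<^sub>v m \<in> S" "\<And>v w. v \<in> S \<Longrightarrow> w \<in> S \<Longrightarrow> v + w \<in> S" "\<And>c v. v \<in> S \<Longrightarrow> c \<cdot>\<^sub>v v \<in> S"
  using submodule.subset[OF subspace.submod[OF assms]] submodule.zero_closed[OF subspace.submod[OF assms]]
    submodule.m_closed[OF subspace.submod[OF assms]] submodule.smult_closed[OF subspace.submod[OF assms]]
  by (simp_all add: module_vec_simps)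

lemma subspaceI:
  assumes "S \<subseteq> carrier_vec m" "0\<^sub>v m \<in> S" "\<And>v w. v \<in> S \<Longrightarrow> w \<in> S \<Longrightarrow> v + w \<in> S" "\<And>c v. v \<in> S \<Longrightarrow> c \<cdot>\<^sub>v v \<in> S"
  shows "VectorSpace.subspace class_ring S (module_vec TYPE(complex) m)"
proof -
  interpret vec_space "TYPE(complex)" m .
  show ?thesis
    by (intro subspace.intro submodule.intro vectorspace_axioms module_axioms) (use assms in \<open>auto simp: module_vec_simps\<close>)
qed

lemma subspace_eq_carrier:
  assumes "VectorSpace.subspace class_ring S (module_vec TYPE(complex) m)"
    and u: "\<And>i. i < m \<Longrightarrow> unit_vec m i \<in> S"
  shows "S = carrier_vec m"
proof (intro equalityI subsetI)
  note S = subspaceD[OF assms(1)]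
  show "v \<in> carrier_vec m" if "v \<in> S" for v using S(1) that by auto
  fix v :: "complex vec" assume v: "v \<in> carrier_vec m"
  \<comment> \<open>Truncations of \<open>v\<close> stand for the partial sums of its expansion in
    unit vectors.\<close>
  have "vec m (\<lambda>i. if i < l then v $ i else 0) \<in> S" if "l \<le> m" for l using that
  proof (induction l)
    case 0
    have "vec m (\<lambda>i. if i < 0 then v $ i else 0) = 0\<^sub>v m" by auto
    then show ?case using S(2) by metis
  next
    case (Suc l)
    have "vec m (\<lambda>i. if i < Suc l then v $ i else 0) = vec m (\<lambda>i. if i < l then v $ i else 0) + (v $ l) \<cdot>\<^sub>v unit_vec m l"
      using Suc.prems by (intro eq_vecI) (auto simp: less_Suc_eq unit_vec_def)
    then show ?case using Suc S(3,4) u by simp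
  qed
  from this[of m] have "vec m (\<lambda>i. if i < m then v $ i else 0) \<in> S" by simp
  moreover have "vec m (\<lambda>i. if i < m then v $ i else 0) = v" using v by auto
  ultimately show "v \<in> S" by simp
qed

section \<open>The shift datum of an enumerated flag\<close>

locale flag_enum =
  fixes r s :: nat and n :: "nat \<Rightarrow> nat" and E :: "nat \<Rightarrow> box set" and e :: "nat \<Rightarrow> nat \<Rightarrow> box"
  assumes s: "0 < s" and flag: "is_flag r s n E"
    and e: "\<And>k. k < s \<Longrightarrow> bij_betw (e k) {..<n k} (E k)"
begin

abbreviation "X \<equiv> shift_datum r s n e"

lemma inj: "k < s \<Longrightarrow> inj_on (e k) {..<n k}" and img: "k < s \<Longrightarrow> e k ` {..<n k} = E k"
  using e unfolding bij_betw_def by auto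

lemma enum_in: "k < s \<Longrightarrow> j < n k \<Longrightarrow> e k j \<in> E k" using img by blast

lemma E_0: "shift1 p \<in> E 0 \<Longrightarrow> p \<in> E 0" "shift2 p \<in> E 0 \<Longrightarrow> p \<in> E 0" "p \<in> E 0 \<Longrightarrow> fst p < r"
proof -
  note f = flag[unfolded is_flag_def]
  from f[THEN conjunct2, THEN conjunct1, rule_format, of p]
  show "shift1 p \<in> E 0 \<Longrightarrow> p \<in> E 0" "shift2 p \<in> E 0 \<Longrightarrow> p \<in> E 0" by simp_all
  show "p \<in> E 0 \<Longrightarrow> fst p < r" using f[THEN conjunct1] by auto
qed

lemma E_Suc: "Suc k < s \<Longrightarrow> E (Suc k) \<subseteq> E k"
  using flag[unfolded is_flag_def, THEN conjunct2, THEN conjunct2, THEN conjunct1, rule_format, of "Suc k"]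
  by simp

lemma E_sub_0: "k < s \<Longrightarrow> E k \<subseteq> E 0"
  by (induction k) (use E_Suc in \<open>simp, meson Suc_lessD order_trans\<close>)

text \<open>Submodule property: raising a box of \<open>E k\<close> either stays in
  \<open>E k\<close> or leaves \<open>E 0\<close> altogether.\<close>

lemma E_up: "k < s \<Longrightarrow> p \<in> E k \<Longrightarrow> shift1 p \<in> E 0 \<Longrightarrow> shift1 p \<in> E k"
  "k < s \<Longrightarrow> p \<in> E k \<Longrightarrow> shift2 p \<in> E 0 \<Longrightarrow> shift2 p \<in> E k"
  using flag[unfolded is_flag_def, THEN conjunct2, THEN conjunct2, THEN conjunct2, THEN conjunct1, rule_format, of k p]
  by simp_all

lemma mult_shift:
  assumes "k < s" "l < s" "m < s"
    and "\<And>p. p \<in> E k \<Longrightarrow> \<tau> (\<sigma> p) \<in> E m \<Longrightarrow> \<sigma> p \<in> E l"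
  shows "incidence_mat (n m) (e m) \<tau> (n l) (e l) * incidence_mat (n l) (e l) \<sigma> (n k) (e k)
    = incidence_mat (n m) (e m) (\<tau> \<circ> \<sigma>) (n k) (e k)"
  by (rule incidence_mat_mult) (use assms inj img enum_in in auto)

lemma shift_datum_maps: "X \<in> nested_adhm_maps r s n"
  unfolding nested_adhm_maps_def shift_datum_def by simp

lemma shift_commute: "shift1 \<circ> shift2 = shift2 \<circ> shift1" by (rule ext) auto

text \<open>No path between two boxes of \<open>E k\<close> leaves \<open>E k\<close>: the
  intermediate box is below a box of \<open>E 0\<close>, hence in \<open>E 0\<close>, hence in
  \<open>E k\<close> by upward closure. So both products are the diagonal shift.\<close>

lemma B_commute:
  assumes k: "k < s"
  shows "fB1 X k * fB2 X k = fB2 X k * fB1 X k"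
proof -
  have "shift2 p \<in> E k" if "p \<in> E k" "shift1 (shift2 p) \<in> E k" for p
    by (rule E_up(2)[OF k that(1) E_0(1)[OF subsetD[OF E_sub_0[OF k] that(2)]]])
  then have "incidence_mat (n k) (e k) shift1 (n k) (e k) * incidence_mat (n k) (e k) shift2 (n k) (e k)
    = incidence_mat (n k) (e k) (shift1 \<circ> shift2) (n k) (e k)"
    by (rule mult_shift[OF k k k])
  moreover have "shift1 p \<in> E k" if "p \<in> E k" "shift2 (shift1 p) \<in> E k" for p
    by (rule E_up(1)[OF k that(1) E_0(2)[OF subsetD[OF E_sub_0[OF k] that(2)]]])
  then have "incidence_mat (n k) (e k) shift2 (n k) (e k) * incidence_mat (n k) (e k) shift1 (n k) (e k)
    = incidence_mat (n k) (e k) (shift2 \<circ> shift1) (n k) (e k)"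
    by (rule mult_shift[OF k k k])
  ultimately show ?thesis using k by (simp add: shift_commute shift_datum_def)
qed

text \<open>A shifted box that survives in \<open>E (k - 1)\<close> lies in \<open>E 0\<close>, so
  upward closure keeps it in \<open>E k\<close> and the route through V_k loses nothing.\<close>

lemma BF_commute:
  assumes k: "k \<in> {1..<s}"
  shows "fB1 X (k - 1) * fF X k = fF X k * fB1 X k" "fB2 X (k - 1) * fF X k = fF X k * fB2 X k"
proof -
  have k': "k < s" "k - 1 < s" "E k \<subseteq> E (k - 1)" using k E_Suc[of "k - 1"] by auto
  note sub = E_sub_0[OF k'(2)]
  have "incidence_mat (n (k - 1)) (e (k - 1)) \<sigma> (n (k - 1)) (e (k - 1)) *
      incidence_mat (n (k - 1)) (e (k - 1)) id (n k) (e k)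
    = incidence_mat (n (k - 1)) (e (k - 1)) id (n k) (e k) * incidence_mat (n k) (e k) \<sigma> (n k) (e k)"
    if "\<And>p. p \<in> E k \<Longrightarrow> \<sigma> p \<in> E 0 \<Longrightarrow> \<sigma> p \<in> E k" for \<sigma>
  proof -
    have 1: "id p \<in> E (k - 1)" if "p \<in> E k" for p using k'(3) that by auto
    have 2: "\<sigma> p \<in> E k" if "p \<in> E k" "id (\<sigma> p) \<in> E (k - 1)" for p
      using \<open>\<And>p. p \<in> E k \<Longrightarrow> \<sigma> p \<in> E 0 \<Longrightarrow> \<sigma> p \<in> E k\<close>[OF that(1)] that(2) sub by auto
    show ?thesis
      using mult_shift[OF k'(1,2,2), of \<sigma> id, OF 1] mult_shift[OF k'(1,1,2), of id \<sigma>, OF 2]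
      by (simp only: comp_id id_comp)
  qed
  from this[of shift1] this[of shift2]
  show "fB1 X (k - 1) * fF X k = fF X k * fB1 X k" "fB2 X (k - 1) * fF X k = fF X k * fB2 X k"
    using E_up[OF k'(1)] k k' by (simp_all add: shift_datum_def)
qed

lemma shift_datum_data:
  assumes s2: "2 \<le> s"
  shows "X \<in> nested_adhm_data r s n"
proof -
  note D = mapsD[OF shift_datum_maps]
  have F: "fF X k \<in> carrier_mat (n (k - Suc 0)) (n k)" if "Suc 0 \<le> k \<and> k < s" for k
    using D(5) that by simp
  have sub: "A - B = 0\<^sub>m a b" if "A = B" "B \<in> carrier_mat a b" for A B :: "complex mat" and a b
    using that by auto
  have [simp]: "fJ X = 0\<^sub>m r (n 0)" "\<And>k. k \<in> {1..<s} \<Longrightarrow> fG X k = 0\<^sub>m (n k) (n (k - 1))"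
    by (auto simp: shift_datum_def)
  have 0: "fB1 X k * fB2 X k - fB2 X k * fB1 X k = 0\<^sub>m (n k) (n k)" if "k < s" for k
    using B_commute[OF that] mult_carrier_mat[OF D(2,1)[OF that]] by (rule sub)
  have 1: "fB1 X (k - 1) * fF X k - fF X k * fB1 X k = 0\<^sub>m (n (k - 1)) (n k)"
    "fB2 X (k - 1) * fF X k - fF X k * fB2 X k = 0\<^sub>m (n (k - 1)) (n k)" if "k \<in> {1..<s}" for k
    using sub[OF BF_commute(1)[OF that] mult_carrier_mat[OF D(5)[OF that] D(1)]]
      sub[OF BF_commute(2)[OF that] mult_carrier_mat[OF D(5)[OF that] D(2)]] that by auto
  have 2: "fG X k * fB1 X (k - 1) - fB1 X k * fG X k = 0\<^sub>m (n k) (n (k - 1))"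
     "fG X k * fB2 X (k - 1) - fB2 X k * fG X k = 0\<^sub>m (n k) (n (k - 1))"
     "fF X k * fG X k = 0\<^sub>m (n (k - 1)) (n (k - 1))" if k: "k \<in> {1..<s}" for k
  proof -
    have k': "k < s" "k - 1 < s" using k by auto
    show "fG X k * fB1 X (k - 1) - fB1 X k * fG X k = 0\<^sub>m (n k) (n (k - 1))"
     "fG X k * fB2 X (k - 1) - fB2 X k * fG X k = 0\<^sub>m (n k) (n (k - 1))"
     "fF X k * fG X k = 0\<^sub>m (n (k - 1)) (n (k - 1))"
      using k D(5)[OF k] D(1)[OF k'(1)] D(1)[OF k'(2)] D(2)[OF k'(1)] D(2)[OF k'(2)]
      by (simp_all add: left_mult_zero_mat right_mult_zero_mat)
  qed
  have 3: "fI X * fJ X = 0\<^sub>m (n 0) (n 0)" "fJ X * fF X 1 = 0\<^sub>m r (n 1)" "fG X 1 * fI X = 0\<^sub>m (n 1) r"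
    using D(3) D(5)[of 1] s2 by (simp_all add: left_mult_zero_mat right_mult_zero_mat)
  show ?thesis unfolding nested_adhm_data_def
    using shift_datum_maps 0 1 2 3 s by (auto simp: 0)
qed

lemma col_fI: "a < r \<Longrightarrow> col (fI X) a = indicator_vec (n 0) (e 0) (a, 0, 0)"
  by (simp add: shift_datum_def col_incidence_mat)

lemma mult_B_indicator:
  "fB1 X 0 *\<^sub>v indicator_vec (n 0) (e 0) p = indicator_vec (n 0) (e 0) (shift1 p)"
  "fB2 X 0 *\<^sub>v indicator_vec (n 0) (e 0) p = indicator_vec (n 0) (e 0) (shift2 p)"
proof -
  have "incidence_mat (n 0) (e 0) \<sigma> (n 0) (e 0) *\<^sub>v indicator_vec (n 0) (e 0) p = indicator_vec (n 0) (e 0) (\<sigma> p)"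
    if "\<sigma> p \<in> E 0 \<Longrightarrow> p \<in> E 0" for \<sigma>
    by (rule incidence_mat_mult_indicator) (use that s inj img[OF s] in auto)
  then show "fB1 X 0 *\<^sub>v indicator_vec (n 0) (e 0) p = indicator_vec (n 0) (e 0) (shift1 p)"
    "fB2 X 0 *\<^sub>v indicator_vec (n 0) (e 0) p = indicator_vec (n 0) (e 0) (shift2 p)"
    using E_0(1,2)[of p] s by (simp_all add: shift_datum_def)
qed

lemma box_vec_shift_datum:
  assumes "fst p < r"
  shows "box_vec X p = indicator_vec (n 0) (e 0) p"
proof -
  obtain a i j where p: "p = (a, i, j)" by (cases p)
  have "((\<lambda>v. fB2 X 0 *\<^sub>v v) ^^ j) (col (fI X) a) = indicator_vec (n 0) (e 0) (a, 0, j)"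
  proof (induction j)
    case 0
    then show ?case using assms p by (simp add: col_fI)
  qed (simp add: mult_B_indicator)
  then have "box_vec X (a, i, j) = indicator_vec (n 0) (e 0) (a, i, j)"
    by (induction i) (simp_all add: mult_B_indicator)
  then show ?thesis using p by simp
qed

lemma F_chain_shift_datum:
  "k < s \<Longrightarrow> F_chain n X k = incidence_mat (n 0) (e 0) id (n k) (e k)"
proof (induction k)
  case 0
  show ?case by (simp only: F_chain.simps incidence_mat_id[OF inj[OF s]])
next
  case (Suc k)
  have F: "fF X (Suc k) = incidence_mat (n k) (e k) id (n (Suc k)) (e (Suc k))"
    using Suc.prems by (simp add: shift_datum_def)
  have "F_chain n X (Suc k) = incidence_mat (n 0) (e 0) id (n k) (e k) * incidence_mat (n k) (e k) id (n (Suc k)) (e (Suc k))"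
    by (simp only: F_chain.simps Suc.IH[OF Suc_lessD[OF Suc.prems]] F)
  also have "\<dots> = incidence_mat (n 0) (e 0) (id \<circ> id) (n (Suc k)) (e (Suc k))"
    using Suc.prems E_Suc[of k] by (intro mult_shift) auto
  finally show ?case by (simp only: comp_id)
qed

lemma indicator_vec_nonzero: "p \<in> E 0 \<longleftrightarrow> indicator_vec (n 0) (e 0) p \<noteq> 0\<^sub>v (n 0)"
proof
  assume "p \<in> E 0"
  then obtain i where "i < n 0" "p = e 0 i" using img[OF s] by blast
  then have "indicator_vec (n 0) (e 0) p $ i \<noteq> 0\<^sub>v (n 0) $ i" by (simp add: indicator_vec_def)
  then show "indicator_vec (n 0) (e 0) p \<noteq> 0\<^sub>v (n 0)" by auto
next
  assume nz: "indicator_vec (n 0) (e 0) p \<noteq> 0\<^sub>v (n 0)"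
  have "\<exists>i<n 0. e 0 i = p"
  proof (rule ccontr)
    assume "\<not> (\<exists>i<n 0. e 0 i = p)"
    then have "indicator_vec (n 0) (e 0) p = 0\<^sub>v (n 0)"
      by (intro eq_vecI) (auto simp: indicator_vec_def)
    with nz show False by simp
  qed
  then show "p \<in> E 0" using enum_in s by auto
qed

lemma box_support_shift_datum:
  assumes k: "k < s"
  shows "box_support r n X k = E k"
proof (intro equalityI subsetI)
  fix p assume p: "p \<in> E k"
  have p0: "p \<in> E 0" using E_sub_0[OF k] p by auto
  have "F_chain n X k *\<^sub>v indicator_vec (n k) (e k) p = box_vec X p"
    using incidence_mat_mult_indicator[OF inj[OF k], of p id "e 0" "n 0"] p img[OF k]
    by (simp add: F_chain_shift_datum[OF k] box_vec_shift_datum E_0(3)[OF p0])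
  moreover have "box_vec X p \<noteq> 0\<^sub>v (n 0)" "fst p < r"
    using p0 indicator_vec_nonzero E_0(3)[OF p0] by (simp_all add: box_vec_shift_datum)
  ultimately show "p \<in> box_support r n X k"
    unfolding box_support_def using indicator_vec_carrier by (metis (mono_tags, lifting) mem_Collect_eq)
next
  fix p assume "p \<in> box_support r n X k"
  then obtain u where u: "u \<in> carrier_vec (n k)" "box_vec X p = F_chain n X k *\<^sub>v u"
    "fst p < r" "box_vec X p \<noteq> 0\<^sub>v (n 0)" unfolding box_support_def by auto
  note v = box_vec_shift_datum[OF u(3)]
  have "p \<in> E 0" using u indicator_vec_nonzero v by simp
  then obtain i where i: "i < n 0" "p = e 0 i" using img[OF s] by blast
  show "p \<in> E k"
  proof (rule ccontr)
    assume "p \<notin> E k"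
    then have "e 0 i \<noteq> e k j" if "j < n k" for j using enum_in[OF k that] i by auto
    \<comment> \<open>The row of the inclusion matrix at a box outside \<open>E k\<close> vanishes,
      whereas the box vector has coordinate 1 there.\<close>
    then have "(F_chain n X k *\<^sub>v u) $ i = 0" unfolding F_chain_shift_datum[OF k]
      using i(1) u(1) by (auto simp: incidence_mat_def scalar_prod_def intro!: sum.neutral)
    moreover have "(F_chain n X k *\<^sub>v u) $ i = 1"
      using u(2) v i by (simp add: indicator_vec_def)
    ultimately show False by simp
  qed
qed

lemma indicator_vec_enum:
  assumes "i < n 0"
  shows "indicator_vec (n 0) (e 0) (e 0 i) = unit_vec (n 0) i"
  using inj[OF s] assms by (intro eq_vecI) (auto simp: indicator_vec_def inj_on_def)

lemma shift_datum_stable: "stable r s n X"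
proof -
  have "inj_on (\<lambda>v. fF X k *\<^sub>v v) (carrier_vec (n k))" if k: "k \<in> {1..<s}" for k
  proof (rule inj_on_inverseI)
    fix v :: "complex vec" assume v: "v \<in> carrier_vec (n k)"
    have k': "k < s" "k - 1 < s" "E k \<subseteq> E (k - 1)" using k E_Suc[of "k - 1"] by auto
    \<comment> \<open>The transpose of the inclusion, which is a left inverse of it.\<close>
    let ?G = "incidence_mat (n k) (e k) id (n (k - 1)) (e (k - 1))"
    have F: "fF X k = incidence_mat (n (k - 1)) (e (k - 1)) id (n k) (e k)" using k by (simp add: shift_datum_def)
    have "?G * fF X k = incidence_mat (n k) (e k) (id \<circ> id) (n k) (e k)"
      unfolding F using k' by (intro mult_shift) auto
    then have "?G * fF X k = 1\<^sub>m (n k)" using inj[OF k'(1)] by (simp add: incidence_mat_id)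
    then show "?G *\<^sub>v (fF X k *\<^sub>v v) = v"
      using v assoc_mult_mat_vec[of ?G "n k" "n (k - 1)" "fF X k" "n k" v] unfolding F by simp
  qed
  moreover have False
    if S: "VectorSpace.subspace class_ring S (module_vec TYPE(complex) (n 0))" "S \<subset> carrier_vec (n 0)"
      "(\<lambda>v. fB1 X 0 *\<^sub>v v) ` S \<subseteq> S" "(\<lambda>v. fB2 X 0 *\<^sub>v v) ` S \<subseteq> S"
      "(\<lambda>w. fI X *\<^sub>v w) ` carrier_vec r \<subseteq> S" for S
  proof -
    \<comment> \<open>An invariant \<open>S\<close> contains the columns of I, then their translates
      by \<open>B_2\<close>, then the translates of those by \<open>B_1\<close>; all unit vectors
      are among them.\<close>
    have 0: "indicator_vec (n 0) (e 0) (a, 0, 0) \<in> S" if "a < r" for a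
    proof -
      have "fI X *\<^sub>v unit_vec r a \<in> S" using S(5) by auto
      moreover have "fI X *\<^sub>v unit_vec r a = col (fI X) a"
        using that mapsD(3)[OF shift_datum_maps] by (simp add: mat_mult_unit_vec)
      ultimately show ?thesis using that col_fI by simp
    qed
    have 1: "indicator_vec (n 0) (e 0) (a, 0, j) \<in> S" if "a < r" for a j
    proof (induction j)
      case (Suc j)
      then have "fB2 X 0 *\<^sub>v indicator_vec (n 0) (e 0) (a, 0, j) \<in> S" using S(4) by auto
      then show ?case by (simp add: mult_B_indicator)
    qed (use 0 that in auto)
    have 2: "indicator_vec (n 0) (e 0) (a, i, j) \<in> S" if "a < r" for a i j
    proof (induction i)
      case (Suc i)
      then have "fB1 X 0 *\<^sub>v indicator_vec (n 0) (e 0) (a, i, j) \<in> S" using S(3) by auto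
      then show ?case by (simp add: mult_B_indicator)
    qed (use 1 that in auto)
    have "unit_vec (n 0) i \<in> S" if "i < n 0" for i
    proof -
      obtain a b c where "e 0 i = (a, b, c)" by (cases "e 0 i")
      then show ?thesis using 2[of a b c] E_0(3)[OF enum_in[OF s that]] unfolding indicator_vec_enum[OF that, symmetric] by simp
    qed
    then show False using subspace_eq_carrier[OF S(1)] S(2) by auto
  qed
  ultimately show ?thesis unfolding stable_def by (intro conjI ballI notI) (assumption, elim exE conjE)
qed

lemma shift_datum_torus_equiv:
  assumes t: "t \<in> torus r"
  shows "gauge_equiv s n X (torus_action r s t X)"
proof -
  obtain t1 t2 \<rho> where tt: "t = (t1, t2, \<rho>)" by (cases t)
  then have nz: "t1 \<noteq> 0" "t2 \<noteq> 0" "\<And>a. a < r \<Longrightarrow> \<rho> a \<noteq> 0" using t unfolding torus_def by auto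
  \<comment> \<open>The character of the torus on a monomial; the inverse of \<open>\<rho>\<close>
    comes from its action on I. It depends on the box and not on \<open>k\<close>, so the diagonal
    matrices commute with the inclusions F.\<close>
  define w :: "box \<Rightarrow> complex" where "w = (\<lambda>(a, i, j). t1 ^ i * t2 ^ j * inverse (\<rho> a))"
  define g where "g k = mat_diag (n k) (\<lambda>i. w (e k i))" for k
  have gc: "g k \<in> carrier_mat (n k) (n k)" for k unfolding g_def by simp
  have w0: "w p \<noteq> 0" if "p \<in> E 0" for p using nz E_0(3)[OF that] unfolding w_def by (cases p) auto
  have wi: "w (e k i) \<noteq> 0" if "k < s" "i < n k" for k i
    by (rule w0[OF subsetD[OF E_sub_0[OF that(1)] enum_in[OF that]]])
  have one: "mat_diag (n k) (\<lambda>i. f i * h i) = 1\<^sub>m (n k)" if "\<And>i. i < n k \<Longrightarrow> f i * h i = 1" for f h :: "nat \<Rightarrow> complex" and k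
    using that by (intro eq_matI) (auto simp: mat_diag_def)
  have G: "g k \<in> carrier (GL (n k))" if "k < s" for k
    unfolding g_def by (rule GL_I(1)[where h="mat_diag (n k) (\<lambda>i. inverse (w (e k i)))"])
      (use wi[OF that] in \<open>auto intro!: one\<close>)
  have ws: "w (shift1 p) = t1 * w p" "w (shift2 p) = t2 * w p" for p by (cases p; simp add: w_def)+
  have B: "g k * fB1 X k = (t1 \<cdot>\<^sub>m fB1 X k) * g k" "g k * fB2 X k = (t2 \<cdot>\<^sub>m fB2 X k) * g k" if "k < s" for k
    using that mat_diag_incidence_mat[of "n k" w shift1 "e k" t1 "\<lambda>j. w (e k j)" "n k" "e k"]
      mat_diag_incidence_mat[of "n k" w shift2 "e k" t2 "\<lambda>j. w (e k j)" "n k" "e k"] ws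
    by (simp_all add: shift_datum_def g_def mult_smult_assoc_mat[OF incidence_mat_carrier mat_diag_dim])
  have s1: "1 \<cdot>\<^sub>m A = A" for A :: "complex mat" by (intro eq_matI) auto
  have F: "g (k - 1) * fF X k = fF X k * g k" if "k \<in> {1..<s}" for k
    using that mat_diag_incidence_mat[of "n k" w id "e k" 1 "\<lambda>j. w (e k j)" "n (k - 1)" "e (k - 1)"]
    by (simp add: shift_datum_def g_def s1)
  have I: "g 0 * fI X = fI X * mat_diag r (\<lambda>a. inverse (\<rho> a))"
    using mat_diag_incidence_mat[of r w "\<lambda>a. (a, 0, 0)" id 1 "\<lambda>a. inverse (\<rho> a)" "n 0" "e 0"]
    by (simp add: shift_datum_def g_def s1 w_def)
  have J: "fJ X = (t1 * t2) \<cdot>\<^sub>m (mat_diag r \<rho> * fJ X) * g 0"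
    using gc[of 0] by (simp add: shift_datum_def right_mult_zero_mat[OF mat_diag_dim] left_mult_zero_mat smult_zero_mat)
  have Gz: "g k * fG X k = fG X k * g (k - 1)" if "k \<in> {1..<s}" for k
    using gc[of k] gc[of "k - 1"] that by (simp add: shift_datum_def)
  have "intertwines s g X (torus_action r s t X)"
    unfolding intertwines_def tt using B F I J Gz by simp
  then show ?thesis using G by (rule gauge_equivI[rotated])
qed

end

section \<open>Sums of eigenvectors\<close>

text \<open>Entrywise, so that the rules for sums of complex numbers apply, and over an indexed
  family, so that equal vectors with different labels stay apart.\<close>

definition lin_comb :: "nat \<Rightarrow> 'p set \<Rightarrow> ('p \<Rightarrow> complex) \<Rightarrow> ('p \<Rightarrow> complex vec) \<Rightarrow> complex vec" where
  "lin_comb m A c u = vec m (\<lambda>i. \<Sum>p\<in>A. c p * u p $ i)"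

lemma lin_comb_carrier [simp]: "lin_comb m A c u \<in> carrier_vec m"
  by (simp add: lin_comb_def)

lemma lin_comb_empty: "lin_comb m {} c u = 0\<^sub>v m"
  by (auto simp: lin_comb_def)

lemma lin_comb_insert:
  assumes "finite A" "q \<notin> A" "u q \<in> carrier_vec m"
  shows "lin_comb m (insert q A) c u = c q \<cdot>\<^sub>v u q + lin_comb m A c u"
  using assms by (intro eq_vecI) (auto simp: lin_comb_def)

text \<open>The premise compares scaled vectors, which allows an eigenvalue to move from the vector
  into the coefficient.\<close>

lemma lin_comb_cong:
  "(\<And>p. p \<in> A \<Longrightarrow> c p \<cdot>\<^sub>v u p = d p \<cdot>\<^sub>v w p) \<Longrightarrow> (\<And>p. p \<in> A \<Longrightarrow> u p \<in> carrier_vec m) \<Longrightarrow>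
    (\<And>p. p \<in> A \<Longrightarrow> w p \<in> carrier_vec m) \<Longrightarrow> lin_comb m A c u = lin_comb m A d w"
proof -
  assume e: "\<And>p. p \<in> A \<Longrightarrow> c p \<cdot>\<^sub>v u p = d p \<cdot>\<^sub>v w p"
    and c: "\<And>p. p \<in> A \<Longrightarrow> u p \<in> carrier_vec m" "\<And>p. p \<in> A \<Longrightarrow> w p \<in> carrier_vec m"
  have "c p * u p $ i = d p * w p $ i" if "p \<in> A" "i < m" for p i
    using arg_cong[OF e[OF that(1)], of "\<lambda>v. v $ i"] c[OF that(1)] that(2) by auto
  then show ?thesis by (intro eq_vecI) (auto simp: lin_comb_def intro!: sum.cong)
qed

lemma mult_mat_zero_vec: "A \<in> carrier_mat m k \<Longrightarrow> A *\<^sub>v 0\<^sub>v k = 0\<^sub>v m" for A :: "complex mat"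
  by (intro eq_vecI) auto

lemma mult_mat_lin_comb:
  assumes "finite A" and B: "B \<in> carrier_mat k m" and u: "\<And>p. p \<in> A \<Longrightarrow> u p \<in> carrier_vec m"
  shows "B *\<^sub>v lin_comb m A c u = lin_comb k A c (\<lambda>p. B *\<^sub>v u p)"
  using assms(1) u
proof (induction A)
  case empty
  then show ?case using mult_mat_zero_vec[OF B] by (simp add: lin_comb_empty)
next
  case (insert q A)
  have uq: "u q \<in> carrier_vec m" "B *\<^sub>v u q \<in> carrier_vec k" using insert B by auto
  have "B *\<^sub>v lin_comb m (insert q A) c u = B *\<^sub>v (c q \<cdot>\<^sub>v u q) + B *\<^sub>v lin_comb m A c u"
    using uq insert.hyps by (simp add: lin_comb_insert mult_add_distrib_mat_vec[OF B])
  also have "\<dots> = c q \<cdot>\<^sub>v (B *\<^sub>v u q) + lin_comb k A c (\<lambda>p. B *\<^sub>v u p)"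
    using insert mult_mat_vec[OF B uq(1)] by simp
  also have "\<dots> = lin_comb k (insert q A) c (\<lambda>p. B *\<^sub>v u p)"
    using insert.hyps uq by (simp add: lin_comb_insert)
  finally show ?case .
qed

lemma lin_comb_in_subspace:
  assumes S: "VectorSpace.subspace class_ring S (module_vec TYPE(complex) m)"
    and "finite A" "\<And>p. p \<in> A \<Longrightarrow> u p \<in> carrier_vec m" "\<And>p. p \<in> A \<Longrightarrow> c p \<cdot>\<^sub>v u p \<in> S"
  shows "lin_comb m A c u \<in> S"
  using assms(2-4)
  by (induction A) (use subspaceD(2,3)[OF S] in \<open>auto simp: lin_comb_empty lin_comb_insert\<close>)

text \<open>Inductive because the generating sets below are not assumed finite and facts about the
  span go by rule induction.\<close>

inductive_set lin_span :: "nat \<Rightarrow> complex vec set \<Rightarrow> complex vec set" for m A where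
  zero: "0\<^sub>v m \<in> lin_span m A"
| base: "v \<in> A \<Longrightarrow> v \<in> lin_span m A"
| add: "v \<in> lin_span m A \<Longrightarrow> w \<in> lin_span m A \<Longrightarrow> v + w \<in> lin_span m A"
| smult: "v \<in> lin_span m A \<Longrightarrow> c \<cdot>\<^sub>v v \<in> lin_span m A"

lemma lin_span_carrier:
  assumes "A \<subseteq> carrier_vec m" "v \<in> lin_span m A"
  shows "v \<in> carrier_vec m"
  using assms(2) by induction (use assms(1) in auto)

lemma lin_span_subspace:
  "A \<subseteq> carrier_vec m \<Longrightarrow> VectorSpace.subspace class_ring (lin_span m A) (module_vec TYPE(complex) m)"
  by (rule subspaceI) (auto intro: lin_span.intros dest: lin_span_carrier)

lemma mult_mat_lin_span:
  assumes A: "A \<subseteq> carrier_vec m" and B: "B \<in> carrier_mat k m"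
    and S: "VectorSpace.subspace class_ring S (module_vec TYPE(complex) k)"
    and "\<And>v. v \<in> A \<Longrightarrow> B *\<^sub>v v \<in> S" and "v \<in> lin_span m A"
  shows "B *\<^sub>v v \<in> S"
  using assms(5)
proof induction
  case zero
  then show ?case using mult_mat_zero_vec[OF B] subspaceD(2)[OF S] by simp
next
  case (add v w)
  then show ?case
    using mult_add_distrib_mat_vec[OF B lin_span_carrier[OF A] lin_span_carrier[OF A]] subspaceD(3)[OF S] by simp
next
  case (smult v c)
  then show ?case using mult_mat_vec[OF B lin_span_carrier[OF A]] subspaceD(4)[OF S] by simp
qed (use assms in auto)

lemma zero_subspace: "VectorSpace.subspace class_ring {0\<^sub>v m} (module_vec TYPE(complex) m)"
  by (rule subspaceI) auto

lemma range_subspace: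
  assumes B: "B \<in> carrier_mat k m"
  shows "VectorSpace.subspace class_ring ((\<lambda>v. B *\<^sub>v v) ` carrier_vec m) (module_vec TYPE(complex) k)"
proof (rule subspaceI)
  show "(\<lambda>v. B *\<^sub>v v) ` carrier_vec m \<subseteq> carrier_vec k" using B by auto
  show "0\<^sub>v k \<in> (\<lambda>v. B *\<^sub>v v) ` carrier_vec m"
    by (rule image_eqI[of _ _ "0\<^sub>v m"]) (use mult_mat_zero_vec[OF B] in auto)
next
  fix v w assume "v \<in> (\<lambda>v. B *\<^sub>v v) ` carrier_vec m" "w \<in> (\<lambda>v. B *\<^sub>v v) ` carrier_vec m"
  then obtain x y where "x \<in> carrier_vec m" "y \<in> carrier_vec m" "v = B *\<^sub>v x" "w = B *\<^sub>v y" by auto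
  then show "v + w \<in> (\<lambda>v. B *\<^sub>v v) ` carrier_vec m"
    by (intro image_eqI[of _ _ "x + y"]) (simp_all add: mult_add_distrib_mat_vec[OF B])
next
  fix c v assume "v \<in> (\<lambda>v. B *\<^sub>v v) ` carrier_vec m"
  then obtain x where "x \<in> carrier_vec m" "v = B *\<^sub>v x" by auto
  then show "c \<cdot>\<^sub>v v \<in> (\<lambda>v. B *\<^sub>v v) ` carrier_vec m"
    by (intro image_eqI[of _ _ "c \<cdot>\<^sub>v x"]) (simp_all add: mult_mat_vec[OF B])
qed

text \<open>The generators may come from infinitely many labels; those outside the finite set
  \<open>E\<close> contribute only zero vectors.\<close>

lemma lin_span_eq_lin_comb:
  assumes E: "finite E" and u: "\<And>p. p \<in> E \<Longrightarrow> u p \<in> carrier_vec m"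
    and A: "\<And>v. v \<in> A \<Longrightarrow> v = 0\<^sub>v m \<or> v \<in> u ` E" and "v \<in> lin_span m A"
  shows "\<exists>c. v = lin_comb m E c u"
  using assms(4)
proof induction
  case zero
  show ?case by (intro exI[of _ "\<lambda>_. 0"]) (auto simp: lin_comb_def)
next
  case (base v)
  from A[OF base] show ?case
  proof
    assume "v = 0\<^sub>v m"
    then show ?case by (intro exI[of _ "\<lambda>_. 0"]) (auto simp: lin_comb_def)
  next
    assume "v \<in> u ` E"
    then obtain q where q: "q \<in> E" "v = u q" by auto
    have "(\<Sum>p\<in>E. (if p = q then 1 else 0) * u p $ i) = (\<Sum>p\<in>E. if p = q then u p $ i else 0)" for i
      by (intro sum.cong) auto
    then have "v = lin_comb m E (\<lambda>p. if p = q then 1 else 0) u"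
      using q u[OF q(1)] E by (intro eq_vecI) (auto simp: lin_comb_def)
    then show ?case by blast
  qed
next
  case (add v w)
  then obtain c d where "v = lin_comb m E c u" "w = lin_comb m E d u" by blast
  then have "v + w = lin_comb m E (\<lambda>p. c p + d p) u"
    by (intro eq_vecI) (auto simp: lin_comb_def sum.distrib algebra_simps)
  then show ?case by blast
next
  case (smult v k)
  then obtain c where "v = lin_comb m E c u" by blast
  then have "k \<cdot>\<^sub>v v = lin_comb m E (\<lambda>p. k * c p) u"
    by (intro eq_vecI) (auto simp: lin_comb_def sum_distrib_left algebra_simps)
  then show ?case by blast
qed

text \<open>Stability in the form used below: the span is an invariant subspace containing the image
  of I, so it cannot be proper.\<close>

lemma stable_lin_span:
  assumes X: "X \<in> nested_adhm_maps r s n" and s: "0 < s" and st: "stable r s n X"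
    and A: "A \<subseteq> carrier_vec (n 0)"
    and B: "\<And>v. v \<in> A \<Longrightarrow> fB1 X 0 *\<^sub>v v \<in> A" "\<And>v. v \<in> A \<Longrightarrow> fB2 X 0 *\<^sub>v v \<in> A"
    and I: "\<And>a. a < r \<Longrightarrow> col (fI X) a \<in> A"
  shows "lin_span (n 0) A = carrier_vec (n 0)"
proof (rule ccontr)
  let ?S = "lin_span (n 0) A"
  assume ne: "?S \<noteq> carrier_vec (n 0)"
  note D = mapsD[OF X] and S = lin_span_subspace[OF A]
  have "?S \<subset> carrier_vec (n 0)" using ne lin_span_carrier[OF A] by auto
  moreover have "(\<lambda>v. fB1 X 0 *\<^sub>v v) ` ?S \<subseteq> ?S"
    using mult_mat_lin_span[OF A D(1)[OF s] S] B(1) lin_span.base by blast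
  moreover have "(\<lambda>v. fB2 X 0 *\<^sub>v v) ` ?S \<subseteq> ?S"
    using mult_mat_lin_span[OF A D(2)[OF s] S] B(2) lin_span.base by blast
  \<comment> \<open>The preimage of the span under I is a subspace containing all unit vectors, so
    checking the columns of I is enough.\<close>
  moreover have "{w \<in> carrier_vec r. fI X *\<^sub>v w \<in> ?S} = carrier_vec r"
  proof (rule subspace_eq_carrier)
    show "VectorSpace.subspace class_ring {w \<in> carrier_vec r. fI X *\<^sub>v w \<in> ?S} (module_vec TYPE(complex) r)"
      using subspaceD(2-4)[OF S] mult_mat_zero_vec[OF D(3)]
      by (intro subspaceI) (auto simp: mult_add_distrib_mat_vec[OF D(3)] mult_mat_vec[OF D(3)])
    show "unit_vec r i \<in> {w \<in> carrier_vec r. fI X *\<^sub>v w \<in> ?S}" if "i < r" for i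
      using that I[OF that] by (auto simp: mat_mult_unit_vec[OF D(3)] intro: lin_span.base)
  qed
  then have "(\<lambda>w. fI X *\<^sub>v w) ` carrier_vec r \<subseteq> ?S" by auto
  ultimately show False using st S unfolding stable_def by blast
qed

text \<open>Applying \<open>g\<close> minus \<open>lam q\<close> kills the term of \<open>q\<close>
  and multiplies each other term by the nonzero number \<open>lam p - lam q\<close>; the induction
  hypothesis puts those terms in \<open>U\<close>, and subtraction gives the last one. With
  \<open>U\<close> zero this yields independence of nonzero eigenvectors; with \<open>U\<close> a
  range it splits elements of an invariant subspace.\<close>

lemma eigen_separation:
  assumes U: "VectorSpace.subspace class_ring U (module_vec TYPE(complex) m)"
    and g: "g \<in> carrier_mat m m" "\<And>w. w \<in> U \<Longrightarrow> g *\<^sub>v w \<in> U"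
    and A: "finite A" "inj_on lam A"
    and v: "\<And>p. p \<in> A \<Longrightarrow> v p \<in> carrier_vec m" "\<And>p. p \<in> A \<Longrightarrow> g *\<^sub>v v p = lam p \<cdot>\<^sub>v v p"
    and w: "lin_comb m A c v \<in> U" and p: "p \<in> A"
  shows "c p \<cdot>\<^sub>v v p \<in> U"
  using A v w p
proof (induction A arbitrary: c p)
  case (insert q A)
  note UD = subspaceD[OF U]
  let ?w = "lin_comb m (insert q A) c v"
  have vq: "v q \<in> carrier_vec m" using insert.prems by auto
  have "g *\<^sub>v ?w = lin_comb m (insert q A) c (\<lambda>p. g *\<^sub>v v p)"
    using insert by (intro mult_mat_lin_comb g) auto
  also have "\<dots> = lin_comb m (insert q A) (\<lambda>p. c p * lam p) v"
    using insert.prems(2,3) by (intro lin_comb_cong) (auto simp: smult_smult_assoc)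
  finally have "g *\<^sub>v ?w + (- lam q) \<cdot>\<^sub>v ?w = lin_comb m A (\<lambda>p. c p * (lam p - lam q)) v"
    using insert.hyps
    by (intro eq_vecI) (auto simp: lin_comb_def sum_subtractf sum_negf sum_distrib_left algebra_simps)
  moreover have "g *\<^sub>v ?w + (- lam q) \<cdot>\<^sub>v ?w \<in> U" using UD(3,4) g(2) insert.prems(4) by auto
  ultimately have l: "lin_comb m A (\<lambda>p. c p * (lam p - lam q)) v \<in> U" by simp
  have inA: "c p \<cdot>\<^sub>v v p \<in> U" if p: "p \<in> A" for p
  proof -
    have "(c p * (lam p - lam q)) \<cdot>\<^sub>v v p \<in> U"
      using insert.IH[OF _ _ _ l p] insert.prems(1-3) by auto
    then have "inverse (lam p - lam q) \<cdot>\<^sub>v ((c p * (lam p - lam q)) \<cdot>\<^sub>v v p) \<in> U" using UD(4) by blast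
    moreover have "lam p \<noteq> lam q" using inj_onD[OF insert.prems(1), of p q] insert.hyps(2) p by blast
    then have "inverse (lam p - lam q) * (c p * (lam p - lam q)) = c p" by (simp add: field_simps)
    ultimately show ?thesis by (simp add: smult_smult_assoc)
  qed
  show ?case
  proof (cases "p = q")
    case True
    have "lin_comb m A c v \<in> U"
      using insert.prems insert.hyps inA by (intro lin_comb_in_subspace[OF U]) auto
    then have "?w + (-1) \<cdot>\<^sub>v lin_comb m A c v \<in> U" using UD(3,4) insert.prems(4) by blast
    moreover have "?w + (-1) \<cdot>\<^sub>v lin_comb m A c v = c q \<cdot>\<^sub>v v q"
      using insert.hyps vq by (intro eq_vecI) (auto simp: lin_comb_def)
    ultimately show ?thesis using True by simp
  qed (use insert.prems inA in auto)
qed simp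

section \<open>Inverting and cancelling matrices\<close>

lemma trace_comm:
  fixes P Q :: "complex mat"
  assumes "Q \<in> carrier_mat k l" "P \<in> carrier_mat l k"
  shows "(\<Sum>i<k. (Q * P) $$ (i, i)) = (\<Sum>j<l. (P * Q) $$ (j, j))"
proof -
  have "(\<Sum>i<k. (Q * P) $$ (i, i)) = (\<Sum>i<k. \<Sum>j<l. Q $$ (i, j) * P $$ (j, i))"
    using assms by (intro sum.cong) (auto simp: scalar_prod_def lessThan_atLeast0)
  also have "\<dots> = (\<Sum>j<l. \<Sum>i<k. P $$ (j, i) * Q $$ (i, j))"
    by (subst sum.swap) (simp add: mult.commute)
  also have "\<dots> = (\<Sum>j<l. (P * Q) $$ (j, j))"
    using assms by (intro sum.cong) (auto simp: scalar_prod_def lessThan_atLeast0)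
  finally show ?thesis .
qed

lemma bijective_mat_invertible:
  fixes Q :: "complex mat"
  assumes Q: "Q \<in> carrier_mat k l"
    and inj: "\<And>c. c \<in> carrier_vec l \<Longrightarrow> Q *\<^sub>v c = 0\<^sub>v k \<Longrightarrow> c = 0\<^sub>v l"
    and surj: "\<And>w. w \<in> carrier_vec k \<Longrightarrow> \<exists>c\<in>carrier_vec l. Q *\<^sub>v c = w"
  shows "l = k" "Q \<in> carrier (GL k)"
proof -
  obtain f where f: "\<And>i. f i \<in> carrier_vec l \<and> Q *\<^sub>v f i = unit_vec k i"
    using surj[OF unit_vec_carrier] by metis
  \<comment> \<open>The columns of the inverse are preimages of the unit vectors. This makes
    \<open>P\<close> a right inverse by construction and a left inverse by injectivity of
    \<open>Q\<close>.\<close>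
  define P where "P = mat l k (\<lambda>(i, j). f j $ i)"
  have P: "P \<in> carrier_mat l k" "\<And>j. j < k \<Longrightarrow> col P j = f j"
  proof -
    have "dim_vec (f j) = l" for j using f by (meson carrier_vecD)
    then show "\<And>j. j < k \<Longrightarrow> col P j = f j" unfolding P_def by (intro eq_vecI) auto
  qed (simp add: P_def)
  have QP: "Q * P = 1\<^sub>m k"
  proof (rule mat_col_eqI)
    fix j assume "j < dim_col (1\<^sub>m k)"
    then have j: "j < k" by simp
    show "col (Q * P) j = col (1\<^sub>m k) j"
      unfolding col_mult2[OF Q P(1) j] P(2)[OF j] using f j by simp
  qed (use Q P in auto)
  have PQ: "P * Q = 1\<^sub>m l"
  proof (rule mat_col_eqI)
    fix j assume "j < dim_col (1\<^sub>m l)"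
    then have j: "j < l" by simp
    have c: "P *\<^sub>v col Q j \<in> carrier_vec l" using P(1) Q by auto
    have "Q *\<^sub>v (P *\<^sub>v col Q j - unit_vec l j) = Q *\<^sub>v (P *\<^sub>v col Q j) - Q *\<^sub>v unit_vec l j"
      using c by (intro mult_minus_distrib_mat_vec[OF Q]) auto
    also have "Q *\<^sub>v (P *\<^sub>v col Q j) = (Q * P) *\<^sub>v col Q j"
      using P Q by (intro assoc_mult_mat_vec[symmetric, OF Q P(1)]) auto
    also have "\<dots> = col Q j" unfolding QP by (rule one_mult_mat_vec) (use Q in auto)
    also have "Q *\<^sub>v unit_vec l j = col Q j" using mat_mult_unit_vec[OF Q j] .
    finally have "Q *\<^sub>v (P *\<^sub>v col Q j - unit_vec l j) = 0\<^sub>v k" using Q by auto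
    then have "P *\<^sub>v col Q j - unit_vec l j = 0\<^sub>v l" using inj c by auto
    then have z: "(P *\<^sub>v col Q j - unit_vec l j) $ i = 0" if "i < l" for i using that by simp
    have "P *\<^sub>v col Q j = unit_vec l j"
    proof (rule eq_vecI)
      fix i assume "i < dim_vec (unit_vec l j)"
      then show "(P *\<^sub>v col Q j) $ i = unit_vec l j $ i" using z[of i] c by simp
    qed (use P(1) in simp)
    then show "col (P * Q) j = col (1\<^sub>m l) j" using j by (simp add: col_mult2[OF P(1) Q])
  qed (use P Q in simp_all)
  (* the traces of Q P and P Q are the two dimensions *)
  have "of_nat k = (of_nat l :: complex)" using trace_comm[OF Q P(1)] by (simp add: QP PQ)
  then show "l = k" by simp
  then show "Q \<in> carrier (GL k)" using GL_I(1)[of Q k P] Q P QP PQ by simp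
qed

lemma mat_eq_of_diff_zero:
  fixes A :: "complex mat"
  assumes A: "A \<in> carrier_mat k l" "B \<in> carrier_mat k l" and z: "A - B = 0\<^sub>m k l"
  shows "A = B"
proof (rule eq_matI)
  fix i j assume "i < dim_row B" "j < dim_col B"
  then show "A $$ (i, j) = B $$ (i, j)" using arg_cong[OF z, of "\<lambda>A. A $$ (i, j)"] A by simp
qed (use A in auto)

text \<open>Left cancellation of an injective matrix. It allows identities between maps into V_k to
  be checked inside V_0, one column at a time.\<close>

lemma mat_cancel:
  fixes F :: "complex mat"
  assumes F: "inj_on (\<lambda>v. F *\<^sub>v v) (carrier_vec k)"
    and A: "A \<in> carrier_mat k l" "B \<in> carrier_mat k l"
    and e: "\<And>j. j < l \<Longrightarrow> F *\<^sub>v col A j = F *\<^sub>v col B j"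
  shows "A = B"
proof (rule mat_col_eqI)
  fix j assume "j < dim_col B"
  then show "col A j = col B j" using inj_onD[OF F e] A by auto
qed (use A in auto)

text \<open>The basis vectors \<open>v p\<close> that lie in the \<open>g\<close>-invariant range of
  \<open>F\<close> form a basis of that range, and \<open>Q\<close> holds their coordinates. The
  length \<open>l\<close> of the enumeration is left open: its equality with \<open>k\<close> is
  what later computes the sizes of the flag.\<close>

lemma eigen_frame:
  assumes g: "g \<in> carrier_mat m m" and E0: "finite E0" "inj_on lam E0"
    and v: "\<And>p. p \<in> E0 \<Longrightarrow> v p \<in> carrier_vec m" "\<And>p. p \<in> E0 \<Longrightarrow> v p \<noteq> 0\<^sub>v m"
      "\<And>p. p \<in> E0 \<Longrightarrow> g *\<^sub>v v p = lam p \<cdot>\<^sub>v v p"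
    and span: "\<And>w. w \<in> carrier_vec m \<Longrightarrow> \<exists>c. w = lin_comb m E0 c v"
    and F: "F \<in> carrier_mat m k" "inj_on (\<lambda>v. F *\<^sub>v v) (carrier_vec k)"
    and h: "h \<in> carrier_mat k k" "g * F = F * h"
  defines "E \<equiv> {p \<in> E0. \<exists>u\<in>carrier_vec k. v p = F *\<^sub>v u}"
  assumes e: "bij_betw e {..<l} E"
  shows "l = k" "\<exists>Q\<in>carrier (GL k). \<forall>j<k. F *\<^sub>v col Q j = v (e j)"
proof -
  define u where "u p = (SOME u. u \<in> carrier_vec k \<and> v p = F *\<^sub>v u)" for p
  have u: "u p \<in> carrier_vec k" "F *\<^sub>v u p = v p" if "p \<in> E" for p
  proof -
    have "\<exists>u. u \<in> carrier_vec k \<and> v p = F *\<^sub>v u" using that unfolding E_def by auto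
    from someI_ex[OF this] show "u p \<in> carrier_vec k" "F *\<^sub>v u p = v p" unfolding u_def by simp_all
  qed
  have E: "E \<subseteq> E0" "finite E" "inj_on lam E"
    using E0 finite_subset[of E E0] inj_on_subset[of lam E0 E] unfolding E_def by auto
  let ?U = "(\<lambda>v. F *\<^sub>v v) ` carrier_vec k"
  define Q where "Q = mat k l (\<lambda>(i, j). u (e j) $ i)"
  have Q: "Q \<in> carrier_mat k l" unfolding Q_def by simp
  have eE: "e j \<in> E" if "j < l" for j using e that unfolding bij_betw_def by auto
  have colQ: "col Q j = u (e j)" if "j < l" for j using u[OF eE[OF that]] that unfolding Q_def by auto
  have QL: "Q *\<^sub>v vec l (\<lambda>j. c (e j)) = lin_comb k E c u" for c
  proof (rule eq_vecI)
    fix i assume "i < dim_vec (lin_comb k E c u)"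
    then have i: "i < k" by (simp add: lin_comb_def)
    have "(\<Sum>j<l. c (e j) * u (e j) $ i) = (\<Sum>p\<in>E. c p * u p $ i)"
      by (rule sum.reindex_bij_betw[OF e])
    then show "(Q *\<^sub>v vec l (\<lambda>j. c (e j))) $ i = lin_comb k E c u $ i"
      using i unfolding Q_def by (simp add: lin_comb_def scalar_prod_def lessThan_atLeast0 mult.commute)
  qed (use Q in \<open>auto simp: lin_comb_def\<close>)
  have FL: "F *\<^sub>v lin_comb k E c u = lin_comb m E c v" for c
    using mult_mat_lin_comb[OF E(2) F(1) u(1)] u v(1) E(1)
    by (auto intro!: lin_comb_cong)
  have inj: "c = 0\<^sub>v l" if c: "c \<in> carrier_vec l" "Q *\<^sub>v c = 0\<^sub>v k" for c
  proof -
    \<comment> \<open>The coefficients \<open>c\<close>, reindexed by boxes instead of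
      positions.\<close>
    define d where "d p = c $ (the_inv_into {..<l} e p)" for p
    have d: "d (e j) = c $ j" if "j < l" for j
      using that e unfolding d_def bij_betw_def by (simp add: the_inv_into_f_f)
    have "c = vec l (\<lambda>j. d (e j))" using c d by auto
    then have "lin_comb m E d v = 0\<^sub>v m"
      using FL QL c mult_mat_zero_vec[OF F(1)] by metis
    then have "d p \<cdot>\<^sub>v v p \<in> {0\<^sub>v m}" if "p \<in> E" for p
      using eigen_separation[OF zero_subspace g _ E(2,3), of v d p] that v E(1) mult_mat_zero_vec[OF g] by auto
    then have d0: "d p = 0" if "p \<in> E" for p
    proof -
      have z: "d p \<cdot>\<^sub>v v p = 0\<^sub>v m" and p: "p \<in> E0" using \<open>\<And>p. p \<in> E \<Longrightarrow> d p \<cdot>\<^sub>v v p \<in> {0\<^sub>v m}\<close> that E(1) by auto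
      show "d p = 0"
      proof (rule ccontr)
        assume nz: "d p \<noteq> 0"
        have "v p $ i = 0" if "i < m" for i
          using arg_cong[OF z, of "\<lambda>w. w $ i"] that v(1)[OF p] nz by auto
        then have "v p = 0\<^sub>v m" using v(1)[OF p] by (intro eq_vecI) auto
        then show False using v(2)[OF p] by simp
      qed
    qed
    show ?thesis using c d d0 eE by (intro eq_vecI) auto
  qed
  have surj: "\<exists>c\<in>carrier_vec l. Q *\<^sub>v c = w" if w: "w \<in> carrier_vec k" for w
  proof -
    obtain c where c: "F *\<^sub>v w = lin_comb m E0 c v" using span[of "F *\<^sub>v w"] F(1) w by auto
    \<comment> \<open>The relation \<open>g * F = F * h\<close> makes the range invariant, so every
      eigencomponent of \<open>F *\<^sub>v w\<close> lies in it; a component with nonzero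
      coefficient thereby puts its label into \<open>E\<close>.\<close>
    have gU: "g *\<^sub>v x \<in> ?U" if x: "x \<in> ?U" for x
    proof -
      obtain y where y: "y \<in> carrier_vec k" "x = F *\<^sub>v y" using x by auto
      have "g *\<^sub>v x = (g * F) *\<^sub>v y" using assoc_mult_mat_vec[OF g F(1) y(1)] y(2) by simp
      also have "\<dots> = F *\<^sub>v (h *\<^sub>v y)" using assoc_mult_mat_vec[OF F(1) h(1) y(1)] h(2) by simp
      finally show ?thesis using h(1) y(1) by auto
    qed
    have cw: "lin_comb m E0 c v \<in> ?U" using w c by (metis image_eqI)
    have cU: "c p \<cdot>\<^sub>v v p \<in> ?U" if "p \<in> E0" for p
      by (rule eigen_separation[OF range_subspace[OF F(1)] g gU E0 v(1,3) cw]) (use that in auto)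
    have c0: "c p = 0" if p: "p \<in> E0 - E" for p
    proof (rule ccontr)
      assume nz: "c p \<noteq> 0"
      have "inverse (c p) \<cdot>\<^sub>v (c p \<cdot>\<^sub>v v p) \<in> ?U"
        using subspaceD(4)[OF range_subspace[OF F(1)]] cU p by blast
      then have "v p \<in> ?U" using nz by (simp add: smult_smult_assoc)
      then show False using p unfolding E_def by auto
    qed
    have "lin_comb m E0 c v = lin_comb m E c v"
      unfolding lin_comb_def using c0 E0(1) E(1)
      by (intro eq_vecI) (auto intro!: sum.mono_neutral_right)
    then have "F *\<^sub>v w = F *\<^sub>v lin_comb k E c u" using c FL by simp
    then have "w = lin_comb k E c u" using inj_onD[OF F(2)] w by simp
    then show ?thesis using QL[of c] by (intro bexI[of _ "vec l (\<lambda>j. c (e j))"]) auto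
  qed
  note b = bijective_mat_invertible[OF Q inj surj]
  show "l = k" by (rule b)
  have "F *\<^sub>v col Q j = v (e j)" if "j < k" for j using colQ u(2) eE b(1) that by simp
  then show "\<exists>Q\<in>carrier (GL k). \<forall>j<k. F *\<^sub>v col Q j = v (e j)" using b(2) by blast
qed

section \<open>A torus element with distinct weights\<close>

text \<open>The torus acts on I through the inverse of \<open>\<rho>\<close>, so negative powers of
  5 produce the eigenvalue \<open>5 ^ a\<close> on column \<open>a\<close> and keep all weights
  natural numbers.\<close>

definition generic_torus_element :: "nat \<Rightarrow> complex \<times> complex \<times> (nat \<Rightarrow> complex)" where
  "generic_torus_element r = (2, 3, \<lambda>a\<in>{..<r}. inverse (5 ^ a))"

fun weight :: "box \<Rightarrow> nat" where "weight (a, i, j) = 5 ^ a * 2 ^ i * 3 ^ j"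

lemma generic_torus_element_in: "generic_torus_element r \<in> torus r"
  by (auto simp: generic_torus_element_def torus_def)

text \<open>Unique factorisation: the multiplicities of 5, 2 and 3 in the weight are the coordinates
  of the box.\<close>

lemma inj_weight: "inj weight"
proof (rule injI)
  fix p q assume e: "weight p = weight q"
  obtain a i j b k l where pq: "p = (a, i, j)" "q = (b, k, l)" by (cases p; cases q)
  have pr: "prime (2::nat)" "prime (3::nat)" "prime (5::nat)" by simp_all
  have m: "multiplicity x (weight (a, i, j)) = a * multiplicity x 5 + i * multiplicity x 2 + j * multiplicity x 3"
    if "prime x" for x a i j
    using that by (simp add: prime_elem_multiplicity_mult_distrib prime_elem_multiplicity_power_distrib)
  have d: "multiplicity (2::nat) 5 = 0" "multiplicity (2::nat) 3 = 0" "multiplicity (3::nat) 5 = 0"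
    "multiplicity (3::nat) 2 = 0" "multiplicity (5::nat) 2 = 0" "multiplicity (5::nat) 3 = 0"
    by (simp_all add: not_dvd_imp_multiplicity_0)
  have s: "multiplicity x (x::nat) = 1" if "prime x" for x
    using that by (simp add: multiplicity_prime)
  have "multiplicity 5 (weight (a, i, j)) = a" "multiplicity 2 (weight (a, i, j)) = i"
    "multiplicity 3 (weight (a, i, j)) = j" for a i j
    using m[OF pr(1), of a i j] m[OF pr(2), of a i j] m[OF pr(3), of a i j] d s[OF pr(1)] s[OF pr(2)] s[OF pr(3)]
    by (simp_all del: weight.simps)
  then show "p = q" using e unfolding pq by metis
qed

declare box_vec.simps [simp del] weight.simps [simp del]

section \<open>Normal form of torus-fixed data\<close>

locale torus_fixed_datum =
  fixes r s :: nat and n :: "nat \<Rightarrow> nat" and X :: nested_adhm and g :: "nat \<Rightarrow> complex mat"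
  assumes s2: "2 \<le> s" and data: "X \<in> nested_adhm_data r s n" and stable: "stable r s n X"
    and g: "\<And>i. i < s \<Longrightarrow> g i \<in> carrier (GL (n i))"
    and fixed: "intertwines s g X (torus_action r s (generic_torus_element r) X)"
begin

lemma s: "0 < s" using s2 by simp

lemma maps: "X \<in> nested_adhm_maps r s n" using data unfolding nested_adhm_data_def by simp

lemmas D = mapsD[OF maps]
lemmas gc = GL_D(1)[OF g]

lemma fixed_eqs:
  "g 0 * fB1 X 0 = (2 \<cdot>\<^sub>m fB1 X 0) * g 0" "g 0 * fB2 X 0 = (3 \<cdot>\<^sub>m fB2 X 0) * g 0"
  "g 0 * fI X = fI X * mat_diag r (\<lambda>a\<in>{..<r}. 5 ^ a)"
  "fJ X = (6 \<cdot>\<^sub>m (mat_diag r (\<lambda>a\<in>{..<r}. inverse (5 ^ a)) * fJ X)) * g 0"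
proof -
  note I = fixed[unfolded intertwines_def generic_torus_element_def]
  show "g 0 * fB1 X 0 = (2 \<cdot>\<^sub>m fB1 X 0) * g 0" "g 0 * fB2 X 0 = (3 \<cdot>\<^sub>m fB2 X 0) * g 0"
    "fJ X = (6 \<cdot>\<^sub>m (mat_diag r (\<lambda>a\<in>{..<r}. inverse (5 ^ a)) * fJ X)) * g 0"
    using I s by auto
  \<comment> \<open>The two functions may differ from \<open>r\<close> on, where the restriction is
    \<open>undefined\<close>; the matrices see only \<open>a < r\<close>.\<close>
  have "mat_diag r (\<lambda>a. inverse ((\<lambda>a\<in>{..<r}. inverse (5 ^ a)) a)) = mat_diag r (\<lambda>a\<in>{..<r}. (5::complex) ^ a)"
    by (intro eq_matI) (auto simp: mat_diag_def)
  then show "g 0 * fI X = fI X * mat_diag r (\<lambda>a\<in>{..<r}. 5 ^ a)" using I by simp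
qed

text \<open>Moving \<open>g 0\<close> past \<open>B_1\<close> costs a factor 2, past
  \<open>B_2\<close> a factor 3. Stated for any vector of weight \<open>p\<close> and not only for
  \<open>box_vec X p\<close>, so that it covers words in any order before commutation is
  known.\<close>

lemma eigen_shift:
  assumes v: "v \<in> carrier_vec (n 0)" and e: "g 0 *\<^sub>v v = of_nat (weight p) \<cdot>\<^sub>v v"
  shows "g 0 *\<^sub>v (fB1 X 0 *\<^sub>v v) = of_nat (weight (shift1 p)) \<cdot>\<^sub>v (fB1 X 0 *\<^sub>v v)"
    "g 0 *\<^sub>v (fB2 X 0 *\<^sub>v v) = of_nat (weight (shift2 p)) \<cdot>\<^sub>v (fB2 X 0 *\<^sub>v v)"
proof -
  have *: "g 0 *\<^sub>v (B *\<^sub>v v) = (c * of_nat (weight p)) \<cdot>\<^sub>v (B *\<^sub>v v)"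
    if B: "B \<in> carrier_mat (n 0) (n 0)" and gB: "g 0 * B = (c \<cdot>\<^sub>m B) * g 0" for B c
  proof -
    have "g 0 *\<^sub>v (B *\<^sub>v v) = (g 0 * B) *\<^sub>v v" using assoc_mult_mat_vec[OF gc[OF s] B v] by simp
    also have "\<dots> = (c \<cdot>\<^sub>m B) *\<^sub>v (g 0 *\<^sub>v v)"
      unfolding gB by (rule assoc_mult_mat_vec[OF smult_carrier_mat[OF B] gc[OF s] v])
    also have "\<dots> = c \<cdot>\<^sub>v (B *\<^sub>v (of_nat (weight p) \<cdot>\<^sub>v v))"
      unfolding e using B v by (intro eq_vecI) auto
    also have "\<dots> = (c * of_nat (weight p)) \<cdot>\<^sub>v (B *\<^sub>v v)"
      using mult_mat_vec[OF B v] by (simp add: smult_smult_assoc)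
    finally show ?thesis .
  qed
  have w: "2 * of_nat (weight p) = (of_nat (weight (shift1 p)) :: complex)"
    "3 * of_nat (weight p) = (of_nat (weight (shift2 p)) :: complex)" by (cases p; simp add: weight.simps)+
  show "g 0 *\<^sub>v (fB1 X 0 *\<^sub>v v) = of_nat (weight (shift1 p)) \<cdot>\<^sub>v (fB1 X 0 *\<^sub>v v)"
    using *[OF D(1)[OF s] fixed_eqs(1)] unfolding w .
  show "g 0 *\<^sub>v (fB2 X 0 *\<^sub>v v) = of_nat (weight (shift2 p)) \<cdot>\<^sub>v (fB2 X 0 *\<^sub>v v)"
    using *[OF D(2)[OF s] fixed_eqs(2)] unfolding w .
qed

lemma eigen_col:
  assumes a: "a < r"
  shows "g 0 *\<^sub>v col (fI X) a = of_nat (weight (a, 0, 0)) \<cdot>\<^sub>v col (fI X) a"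
proof -
  have "g 0 *\<^sub>v col (fI X) a = col (fI X * mat_diag r (\<lambda>a\<in>{..<r}. 5 ^ a)) a"
    using col_mult2[OF gc[OF s] D(3) a] fixed_eqs(3) by simp
  also have "\<dots> = of_nat (weight (a, 0, 0)) \<cdot>\<^sub>v col (fI X) a"
    unfolding mat_diag_mult_right[OF D(3)] using a D(3) by (intro eq_vecI) (auto simp: weight.simps)
  finally show ?thesis .
qed

text \<open>\<open>J\<close> could only be nonzero on eigenvectors of \<open>g\<^sub>0\<close> with eigenvalue \<open>5\<^sup>b / 6\<close>, but \<open>V\<^sub>0\<close> is
  spanned by eigenvectors with integer eigenvalues.\<close>

lemma fJ_zero: "fJ X = 0\<^sub>m r (n 0)"
proof -
  \<comment> \<open>All vectors with such an eigenvalue, the zero vector included. The set is closed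
    under \<open>B_1\<close> and \<open>B_2\<close> in any order, which at this point cannot be said
    of the ordered monomials.\<close>
  define A where "A = {v \<in> carrier_vec (n 0). \<exists>p. g 0 *\<^sub>v v = of_nat (weight p) \<cdot>\<^sub>v v}"
  have A: "A \<subseteq> carrier_vec (n 0)" unfolding A_def by auto
  have span: "lin_span (n 0) A = carrier_vec (n 0)"
  proof (rule stable_lin_span[OF maps s stable A])
    show "fB1 X 0 *\<^sub>v v \<in> A" "fB2 X 0 *\<^sub>v v \<in> A" if "v \<in> A" for v
      using that eigen_shift[of v] mult_mat_vec_carrier[OF D(1)[OF s]] mult_mat_vec_carrier[OF D(2)[OF s]]
      unfolding A_def by blast+
    show "col (fI X) a \<in> A" if "a < r" for a
    proof -
      have "col (fI X) a \<in> carrier_vec (n 0)" using D(3) that by auto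
      then show ?thesis using eigen_col[OF that] unfolding A_def by blast
    qed
  qed
  have JA: "fJ X *\<^sub>v v \<in> {0\<^sub>v r}" if v: "v \<in> A" for v
  proof -
    obtain p where p: "g 0 *\<^sub>v v = of_nat (weight p) \<cdot>\<^sub>v v" and vc: "v \<in> carrier_vec (n 0)"
      using v unfolding A_def by auto
    let ?d = "mat_diag r (\<lambda>a\<in>{..<r}. inverse (5 ^ a)) :: complex mat"
    have dJ: "?d * fJ X \<in> carrier_mat r (n 0)" using mult_carrier_mat[OF mat_diag_dim D(4)] .
    have "fJ X *\<^sub>v v = (6 \<cdot>\<^sub>m (?d * fJ X)) *\<^sub>v (g 0 *\<^sub>v v)"
      using assoc_mult_mat_vec[OF _ gc[OF s] vc, of "6 \<cdot>\<^sub>m (?d * fJ X)" r] dJ fixed_eqs(4) by simp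
    also have "\<dots> = 6 \<cdot>\<^sub>v ((?d * fJ X) *\<^sub>v (of_nat (weight p) \<cdot>\<^sub>v v))"
      unfolding p using dJ vc by (intro eq_vecI) auto
    also have "\<dots> = (6 * of_nat (weight p)) \<cdot>\<^sub>v ((?d * fJ X) *\<^sub>v v)"
      using mult_mat_vec[OF dJ vc] by (simp add: smult_smult_assoc)
    finally have e: "fJ X *\<^sub>v v = (6 * of_nat (weight p)) \<cdot>\<^sub>v ((?d * fJ X) *\<^sub>v v)" .
    have "(fJ X *\<^sub>v v) $ b = 0" if b: "b < r" for b
    proof -
      have "((?d * fJ X) *\<^sub>v v) $ b = inverse (5 ^ b) * (fJ X *\<^sub>v v) $ b"
        unfolding mat_diag_mult_left[OF D(4)] using D(4) b vc
        by (simp add: scalar_prod_def sum_distrib_left mult.assoc)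
      moreover have "(fJ X *\<^sub>v v) $ b = (6 * of_nat (weight p)) * ((?d * fJ X) *\<^sub>v v) $ b"
        by (subst e, rule index_smult_vec) (use dJ b in auto)
      ultimately have "(fJ X *\<^sub>v v) $ b = (6 * of_nat (weight p)) * (inverse (5 ^ b) * (fJ X *\<^sub>v v) $ b)"
        by metis
      then have "(5 ^ b - 6 * of_nat (weight p)) * (fJ X *\<^sub>v v) $ b = 0"
        by (simp add: field_simps)
      moreover have "(5::complex) ^ b - 6 * of_nat (weight p) \<noteq> 0"
      proof
        assume "(5::complex) ^ b - 6 * of_nat (weight p) = 0"
        then have "of_nat (5 ^ b) = (of_nat (6 * weight p) :: complex)" by simp
        then have "(5::nat) ^ b = 6 * weight p" unfolding of_nat_eq_iff .
        moreover have "odd ((5::nat) ^ b)" by simp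
        ultimately show False by simp
      qed
      ultimately show ?thesis by simp
    qed
    then show ?thesis using D(4) by (auto intro!: eq_vecI)
  qed
  have "fJ X *\<^sub>v v \<in> {0\<^sub>v r}" if "v \<in> carrier_vec (n 0)" for v
    by (rule mult_mat_lin_span[OF A D(4) zero_subspace JA]) (use that span in auto)
  then have "col (fJ X) j = 0\<^sub>v r" if "j < n 0" for j
    using mat_mult_unit_vec[OF D(4) that] by fastforce
  then show ?thesis using D(4) by (intro mat_col_eqI) auto
qed

lemma B_commute: "fB1 X 0 * fB2 X 0 = fB2 X 0 * fB1 X 0"
proof -
  have "(fB1 X 0 * fB2 X 0 - fB2 X 0 * fB1 X 0) + fI X * fJ X = 0\<^sub>m (n 0) (n 0)"
    using data unfolding nested_adhm_data_def by simp
  then have z: "fB1 X 0 * fB2 X 0 - fB2 X 0 * fB1 X 0 = 0\<^sub>m (n 0) (n 0)"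
    using right_mult_zero_mat[OF D(3), of "n 0"] right_add_zero_mat[OF minus_carrier_mat[OF mult_carrier_mat[OF D(2,1)[OF s]]]]
    unfolding fJ_zero by metis
  show ?thesis
    by (rule mat_eq_of_diff_zero[OF mult_carrier_mat[OF D(1,2)[OF s]] mult_carrier_mat[OF D(2,1)[OF s]] z])
qed

lemma box_vec_in: "fst p < r \<Longrightarrow> box_vec X p \<in> carrier_vec (n 0)"
  by (rule box_vec_carrier[OF maps s])

text \<open>Commutation enters here: the new factor \<open>B_2\<close> has to pass all factors
  \<open>B_1\<close>.\<close>

lemma box_vec_shift2:
  assumes "fst p < r"
  shows "box_vec X (shift2 p) = fB2 X 0 *\<^sub>v box_vec X p"
proof -
  obtain a i j where p: "p = (a, i, j)" by (cases p)
  have a: "a < r" using assms p by simp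
  have "box_vec X (a, i, Suc j) = fB2 X 0 *\<^sub>v box_vec X (a, i, j)"
  proof (induction i)
    case 0
    show ?case by (rule box_vec_simps(3))
  next
    case (Suc i)
    let ?v = "box_vec X (a, i, j)"
    have v: "?v \<in> carrier_vec (n 0)" using box_vec_in a by simp
    have "box_vec X (a, Suc i, Suc j) = fB1 X 0 *\<^sub>v (fB2 X 0 *\<^sub>v ?v)"
      using box_vec_simps(2)[of X "(a, i, Suc j)"] Suc by (simp only: shift1.simps)
    also have "\<dots> = fB2 X 0 *\<^sub>v (fB1 X 0 *\<^sub>v ?v)"
      using assoc_mult_mat_vec[OF D(1,2)[OF s] v] assoc_mult_mat_vec[OF D(2,1)[OF s] v] B_commute by metis
    also have "fB1 X 0 *\<^sub>v ?v = box_vec X (a, Suc i, j)"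
      using box_vec_simps(2)[of X "(a, i, j)"] by (simp only: shift1.simps)
    finally show ?case .
  qed
  then show ?thesis using p by (simp only: shift2.simps)
qed

lemma box_vec_eigen:
  assumes "fst p < r"
  shows "g 0 *\<^sub>v box_vec X p = of_nat (weight p) \<cdot>\<^sub>v box_vec X p"
proof -
  obtain a i j where p: "p = (a, i, j)" by (cases p)
  have a: "a < r" using assms p by simp
  have "g 0 *\<^sub>v box_vec X (a, 0, j) = of_nat (weight (a, 0, j)) \<cdot>\<^sub>v box_vec X (a, 0, j)"
  proof (induction j)
    case 0
    show ?case using eigen_col[OF a] by (simp only: box_vec_simps(1))
  next
    case (Suc j)
    from eigen_shift(2)[OF box_vec_in Suc] a
    show ?case by (simp only: box_vec_simps shift2.simps fst_conv)
  qed
  then have "g 0 *\<^sub>v box_vec X (a, i, j) = of_nat (weight (a, i, j)) \<cdot>\<^sub>v box_vec X (a, i, j)"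
  proof (induction i)
    case (Suc i)
    from eigen_shift(1)[OF box_vec_in Suc.IH[OF Suc.prems]] a
    show ?case by (simp only: box_vec_simps(2)[symmetric] shift1.simps fst_conv)
  qed
  then show ?thesis using p by simp
qed

abbreviation "E \<equiv> box_support r n X"

lemma E_0_iff: "p \<in> E 0 \<longleftrightarrow> fst p < r \<and> box_vec X p \<noteq> 0\<^sub>v (n 0)"
  using box_vec_in[of p] unfolding box_support_def by auto

lemma inj_weight_complex: "inj_on (\<lambda>p. of_nat (weight p) :: complex) A"
  by (rule inj_onI) (simp only: of_nat_eq_iff inj_eq[OF inj_weight])

lemma fst_shift: "fst (shift1 p) = fst p" "fst (shift2 p) = fst p"
  by (cases p; simp)+

text \<open>Distinct boxes give distinct eigenvalues of \<open>g 0\<close>, and the spectrum of a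
  matrix is finite.\<close>

lemma finite_E_0: "finite (E 0)"
proof (rule inj_on_finite[OF inj_weight_complex])
  show "(\<lambda>p. of_nat (weight p)) ` E 0 \<subseteq> spectrum (g 0)"
  proof
    fix x :: complex assume "x \<in> (\<lambda>p. of_nat (weight p)) ` E 0"
    then obtain p where p: "x = of_nat (weight p)" "p \<in> E 0" by blast
    then have "eigenvector (g 0) (box_vec X p) x"
      using E_0_iff box_vec_in box_vec_eigen gc[OF s] unfolding eigenvector_def by auto
    then show "x \<in> spectrum (g 0)" unfolding spectrum_def eigenvalue_def by blast
  qed
  show "finite (spectrum (g 0))" using card_finite_spectrum[OF gc[OF s]] by simp
qed

text \<open>The set of all monomial vectors contains the columns of I and is closed under
  \<open>B_1\<close> and \<open>B_2\<close>, so stability makes it span; labels outside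
  \<open>E 0\<close> give zero vectors.\<close>

lemma box_vec_span:
  assumes w: "w \<in> carrier_vec (n 0)"
  shows "\<exists>c. w = lin_comb (n 0) (E 0) c (box_vec X)"
proof (rule lin_span_eq_lin_comb[OF finite_E_0])
  let ?A = "box_vec X ` {p. fst p < r}"
  show "box_vec X p \<in> carrier_vec (n 0)" if "p \<in> E 0" for p using that E_0_iff box_vec_in by simp
  show "v = 0\<^sub>v (n 0) \<or> v \<in> box_vec X ` E 0" if "v \<in> ?A" for v
  proof -
    obtain p where p: "v = box_vec X p" "fst p < r" using \<open>v \<in> ?A\<close> by blast
    show ?thesis unfolding p(1) using p(2) E_0_iff[of p] by blast
  qed
  note f = fst_shift
  have "lin_span (n 0) ?A = carrier_vec (n 0)"
  proof (rule stable_lin_span[OF maps s stable])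
    show "?A \<subseteq> carrier_vec (n 0)" using box_vec_in by auto
    show "fB1 X 0 *\<^sub>v v \<in> ?A" "fB2 X 0 *\<^sub>v v \<in> ?A" if "v \<in> ?A" for v
    proof -
      obtain p where p: "v = box_vec X p" "fst p < r" using \<open>v \<in> ?A\<close> by blast
      show "fB1 X 0 *\<^sub>v v \<in> ?A"
        by (rule image_eqI[of _ _ "shift1 p"]) (simp_all only: p box_vec_simps(2) f mem_Collect_eq)
      show "fB2 X 0 *\<^sub>v v \<in> ?A"
        by (rule image_eqI[of _ _ "shift2 p"]) (simp_all only: p box_vec_shift2[OF p(2)] f mem_Collect_eq)
    qed
    show "col (fI X) a \<in> ?A" if "a < r" for a
      using that box_vec_simps(1)[of X a] by (intro image_eqI[of _ _ "(a, 0, 0)"]) auto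
  qed
  then show "w \<in> lin_span (n 0) ?A" using w by simp
qed

lemma fF_inj: "k \<in> {1..<s} \<Longrightarrow> inj_on (\<lambda>v. fF X k *\<^sub>v v) (carrier_vec (n k))"
  using stable unfolding stable_def by blast

lemma chain_carrier: "k < s \<Longrightarrow> F_chain n X k \<in> carrier_mat (n 0) (n k)"
  by (rule F_chain_carrier[OF maps])

lemma chain_Suc:
  assumes "Suc k < s" "u \<in> carrier_vec (n (Suc k))"
  shows "F_chain n X (Suc k) *\<^sub>v u = F_chain n X k *\<^sub>v (fF X (Suc k) *\<^sub>v u)"
    "fF X (Suc k) *\<^sub>v u \<in> carrier_vec (n k)"
proof -
  have F: "fF X (Suc k) \<in> carrier_mat (n k) (n (Suc k))" using D(5)[of "Suc k"] assms by simp
  show "F_chain n X (Suc k) *\<^sub>v u = F_chain n X k *\<^sub>v (fF X (Suc k) *\<^sub>v u)"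
    using assoc_mult_mat_vec[OF chain_carrier F assms(2)] assms(1) by simp
  show "fF X (Suc k) *\<^sub>v u \<in> carrier_vec (n k)" using F assms by simp
qed

lemma chain_inj: "k < s \<Longrightarrow> inj_on (\<lambda>v. F_chain n X k *\<^sub>v v) (carrier_vec (n k))"
proof (induction k)
  case 0
  show ?case by (auto simp: inj_on_def)
next
  case (Suc k)
  show ?case
  proof (rule inj_onI)
    fix u v assume u: "u \<in> carrier_vec (n (Suc k))" and v: "v \<in> carrier_vec (n (Suc k))"
      and e: "F_chain n X (Suc k) *\<^sub>v u = F_chain n X (Suc k) *\<^sub>v v"
    have "fF X (Suc k) *\<^sub>v u = fF X (Suc k) *\<^sub>v v"
      using inj_onD[OF Suc.IH] chain_Suc[OF Suc.prems u] chain_Suc[OF Suc.prems v] e Suc.prems by simp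
    then show "u = v" using inj_onD[OF fF_inj[of "Suc k"]] u v Suc.prems by simp
  qed
qed

lemma chain_commute:
  assumes "k < s"
  shows "fB1 X 0 * F_chain n X k = F_chain n X k * fB1 X k" "fB2 X 0 * F_chain n X k = F_chain n X k * fB2 X k"
proof -
  have *: "B 0 * F_chain n X k = F_chain n X k * B k"
    if B: "\<And>k. k < s \<Longrightarrow> B k \<in> carrier_mat (n k) (n k)"
      and BF: "\<And>k. k \<in> {1..<s} \<Longrightarrow> B (k - 1) * fF X k - fF X k * B k = 0\<^sub>m (n (k - 1)) (n k)" for B
    using assms
  proof (induction k)
    case 0
    then show ?case using B[OF s] by simp
  next
    case (Suc k)
    have k: "k < s" "Suc k \<in> {1..<s}" using Suc.prems by auto
    have F: "fF X (Suc k) \<in> carrier_mat (n k) (n (Suc k))" using D(5)[OF k(2)] by simp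
    have c: "B k * fF X (Suc k) \<in> carrier_mat (n k) (n (Suc k))" "fF X (Suc k) * B (Suc k) \<in> carrier_mat (n k) (n (Suc k))"
      using mult_carrier_mat[OF B[OF k(1)] F] mult_carrier_mat[OF F B[OF Suc.prems]] .
    have z: "B k * fF X (Suc k) - fF X (Suc k) * B (Suc k) = 0\<^sub>m (n k) (n (Suc k))" using BF[OF k(2)] by simp
    have e: "B k * fF X (Suc k) = fF X (Suc k) * B (Suc k)" by (rule mat_eq_of_diff_zero[OF c z])
    have "B 0 * F_chain n X (Suc k) = (B 0 * F_chain n X k) * fF X (Suc k)"
      using assoc_mult_mat[OF B[OF s] chain_carrier[OF k(1)] F] by simp
    also have "\<dots> = F_chain n X k * (B k * fF X (Suc k))"
      unfolding Suc.IH[OF k(1)] by (rule assoc_mult_mat[OF chain_carrier[OF k(1)] B[OF k(1)] F])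
    also have "\<dots> = F_chain n X (Suc k) * B (Suc k)"
      unfolding e F_chain.simps by (rule assoc_mult_mat[symmetric, OF chain_carrier[OF k(1)] F B[OF Suc.prems]])
    finally show ?case .
  qed
  show "fB1 X 0 * F_chain n X k = F_chain n X k * fB1 X k" "fB2 X 0 * F_chain n X k = F_chain n X k * fB2 X k"
    using data unfolding nested_adhm_data_def by (auto intro!: *[of "fB1 X"] *[of "fB2 X"] D)
qed

lemma chain_mult_B:
  assumes k: "k < s" and u: "u \<in> carrier_vec (n k)"
  shows "F_chain n X k *\<^sub>v (fB1 X k *\<^sub>v u) = fB1 X 0 *\<^sub>v (F_chain n X k *\<^sub>v u)"
    "F_chain n X k *\<^sub>v (fB2 X k *\<^sub>v u) = fB2 X 0 *\<^sub>v (F_chain n X k *\<^sub>v u)"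
  using assoc_mult_mat_vec[OF chain_carrier[OF k] D(1)[OF k] u] assoc_mult_mat_vec[OF chain_carrier[OF k] D(2)[OF k] u]
    assoc_mult_mat_vec[OF D(1)[OF s] chain_carrier[OF k] u] assoc_mult_mat_vec[OF D(2)[OF s] chain_carrier[OF k] u]
    chain_commute[OF k] by simp_all

text \<open>F G = 0 and F is injective.\<close>

lemma fG_zero:
  assumes k: "k \<in> {1..<s}"
  shows "fG X k = 0\<^sub>m (n k) (n (k - 1))"
proof (rule mat_cancel[OF fF_inj[OF k] D(6)[OF k]])
  have z: "fF X k * fG X k = 0\<^sub>m (n (k - 1)) (n (k - 1))" using data k unfolding nested_adhm_data_def by blast
  fix j assume j: "j < n (k - 1)"
  have "fF X k *\<^sub>v col (fG X k) j = 0\<^sub>v (n (k - 1))"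
    using col_mult2[OF D(5)[OF k] D(6)[OF k] j] z j by simp
  also have "\<dots> = fF X k *\<^sub>v col (0\<^sub>m (n k) (n (k - 1))) j"
    using mult_mat_zero_vec[OF D(5)[OF k]] j by simp
  finally show "fF X k *\<^sub>v col (fG X k) j = fF X k *\<^sub>v col (0\<^sub>m (n k) (n (k - 1))) j" .
qed simp

lemma E_alt: "E k = {p \<in> E 0. \<exists>u\<in>carrier_vec (n k). box_vec X p = F_chain n X k *\<^sub>v u}"
  using E_0_iff by (auto simp: box_support_def[of r n X k])

text \<open>As the torus leaves F alone, \<open>g\<close> intertwines the chain with itself, and the
  image of V_k in V_0 is invariant under \<open>g 0\<close>.\<close>

lemma F_chain_torus: "F_chain n (torus_action r s t X) k = F_chain n X k"
  by (cases t, induction k) auto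

lemma frame:
  assumes k: "k < s" and e: "bij_betw e {..<l} (E k)"
  shows "l = n k" "\<exists>Q\<in>carrier (GL (n k)). \<forall>j<n k. F_chain n X k *\<^sub>v col Q j = box_vec X (e j)"
proof -
  have i: "g 0 * F_chain n X k = F_chain n X k * g k"
    using F_chain_intertwines[OF maps torus_action_maps[OF maps] k gc fixed] unfolding F_chain_torus .
  note * = eigen_frame[OF gc[OF s] finite_E_0 inj_weight_complex _ _ _ box_vec_span chain_carrier[OF k]
    chain_inj[OF k] gc[OF k] i e[unfolded E_alt[of k]]]
  show "l = n k" "\<exists>Q\<in>carrier (GL (n k)). \<forall>j<n k. F_chain n X k *\<^sub>v col Q j = box_vec X (e j)"
    by (rule *; use E_0_iff box_vec_in box_vec_eigen in simp)+
qed

lemma finite_E: "finite (E k)"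
  using finite_E_0 unfolding E_alt[of k] by simp

text \<open>Any enumeration of the finite set \<open>E k\<close> has length \<open>n k\<close> by
  \<open>frame\<close>.\<close>

lemma card_E: "k < s \<Longrightarrow> card (E k) = n k"
  using frame(1) ex_bij_betw_nat_finite[OF finite_E] by (metis atLeast0LessThan)

text \<open>The chain commutes with \<open>B_1\<close> and \<open>B_2\<close>, so the image of V_k
  is closed under both.\<close>

lemma shift_in_E:
  assumes k: "k < s" and p: "p \<in> E k"
  shows "shift1 p \<in> E 0 \<Longrightarrow> shift1 p \<in> E k" "shift2 p \<in> E 0 \<Longrightarrow> shift2 p \<in> E k"
proof -
  obtain u where u: "u \<in> carrier_vec (n k)" "box_vec X p = F_chain n X k *\<^sub>v u" and a: "fst p < r"
    using p unfolding box_support_def by auto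
  have "box_vec X (shift1 p) = F_chain n X k *\<^sub>v (fB1 X k *\<^sub>v u)"
    "box_vec X (shift2 p) = F_chain n X k *\<^sub>v (fB2 X k *\<^sub>v u)"
    unfolding box_vec_simps(2) box_vec_shift2[OF a] using chain_mult_B[OF k u(1)] u(2) by simp_all
  moreover have "fB1 X k *\<^sub>v u \<in> carrier_vec (n k)" "fB2 X k *\<^sub>v u \<in> carrier_vec (n k)"
    using D(1,2)[OF k] u(1) by simp_all
  ultimately show "shift1 p \<in> E 0 \<Longrightarrow> shift1 p \<in> E k" "shift2 p \<in> E 0 \<Longrightarrow> shift2 p \<in> E k"
    unfolding E_alt[of k] by blast+
qed

lemma box_support_flag: "is_flag r s n E"
  unfolding is_flag_def
proof (intro conjI allI ballI impI)
  show "E 0 \<subseteq> {..<r} \<times> UNIV" using E_0_iff by auto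
  note f = fst_shift
  show "p \<in> E 0" if "shift1 p \<in> E 0" for p
    using that mult_mat_zero_vec[OF D(1)[OF s]] unfolding E_0_iff f box_vec_simps(2) by auto
  show "p \<in> E 0" if "shift2 p \<in> E 0" for p
    using that mult_mat_zero_vec[OF D(2)[OF s]] box_vec_shift2[of p] unfolding E_0_iff f by auto
  show "E k \<subseteq> E (k - 1)" if k: "k \<in> {1..<s}" for k
  proof -
    obtain m where m: "k = Suc m" "Suc m < s" using k by (cases k) auto
    have "\<exists>u\<in>carrier_vec (n m). box_vec X p = F_chain n X m *\<^sub>v u"
      if "\<exists>u\<in>carrier_vec (n (Suc m)). box_vec X p = F_chain n X (Suc m) *\<^sub>v u" for p
      using that chain_Suc[OF m(2)] by metis
    then have "E (Suc m) \<subseteq> E m" unfolding E_alt[of "Suc m"] E_alt[of m] by blast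
    then show ?thesis by (simp add: m)
  qed
qed (use shift_in_E finite_E card_E in auto)

text \<open>The gauge transformation \<open>Q\<close> writes the monomial basis of each V_k in the
  given coordinates. Relations for B, F and I are verified after applying an injective chain to a
  column, where both sides become the same monomial vector in V_0.\<close>

lemma normal_form:
  assumes e: "\<And>k. k < s \<Longrightarrow> bij_betw (e k) {..<n k} (E k)"
  shows "gauge_equiv s n (shift_datum r s n e) X"
proof -
  interpret flag_enum r s n E e using s box_support_flag e by unfold_locales
  obtain Q where Q: "\<And>k. k < s \<Longrightarrow> Q k \<in> carrier (GL (n k))"
    and QF: "\<And>k j. k < s \<Longrightarrow> j < n k \<Longrightarrow> F_chain n X k *\<^sub>v col (Q k) j = box_vec X (e k j)"
    using frame(2)[OF _ e] by metis
  note Qc = GL_D(1)[OF Q]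
  let ?Y = "shift_datum r s n e"
  \<comment> \<open>Basis vectors of the model go to monomial vectors. The second alternative
    handles a shift that leaves the diagram, where both sides are zero.\<close>
  have ind: "F_chain n X k *\<^sub>v (Q k *\<^sub>v indicator_vec (n k) (e k) p) = box_vec X p"
    if k: "k < s" and p: "p \<in> E k \<or> box_vec X p = 0\<^sub>v (n 0)" for k p
  proof (cases "p \<in> E k")
    case True
    then obtain i where i: "i < n k" "p = e k i" using img[OF k] by blast
    have "indicator_vec (n k) (e k) p = unit_vec (n k) i"
      using inj[OF k] i by (intro eq_vecI) (auto simp: indicator_vec_def inj_on_def)
    then show ?thesis using QF[OF k i(1)] mat_mult_unit_vec[OF Qc[OF k] i(1)] i(2) by simp
  next
    case False
    then have "indicator_vec (n k) (e k) p = 0\<^sub>v (n k)"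
      using enum_in[OF k] by (intro eq_vecI) (auto simp: indicator_vec_def)
    then show ?thesis
      using False p mult_mat_zero_vec[OF Qc[OF k]] mult_mat_zero_vec[OF chain_carrier[OF k]] by simp
  qed
  have col_inc: "F_chain n X k *\<^sub>v col (Q k * incidence_mat (n k) (e k) \<sigma> l e') j = box_vec X (\<sigma> (e' j))"
    if "k < s" "j < l" "\<sigma> (e' j) \<in> E k \<or> box_vec X (\<sigma> (e' j)) = 0\<^sub>v (n 0)"
    for k j l \<sigma> e'
    using ind[OF that(1,3)]
    by (simp only: col_mult2[OF Qc[OF that(1)] incidence_mat_carrier that(2)] col_incidence_mat[OF that(2)])
  have ar: "fst p < r" if "k < s" "p \<in> E k" for k p using that unfolding box_support_def by simp
  note f = fst_shift
  \<comment> \<open>A shifted box of \<open>E k\<close> stays in \<open>E k\<close> or has zero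
    vector, which is exactly the case distinction of \<open>ind\<close>.\<close>
  have sh: "shift1 p \<in> E k \<or> box_vec X (shift1 p) = 0\<^sub>v (n 0)" "shift2 p \<in> E k \<or> box_vec X (shift2 p) = 0\<^sub>v (n 0)"
    if "k < s" "p \<in> E k" for k p
    using shift_in_E[OF that] E_0_iff ar[OF that] f by auto
  have 1: "Q k * fB1 ?Y k = fB1 X k * Q k" if k: "k < s" for k
  proof (rule mat_cancel[OF chain_inj[OF k]])
    fix j assume j: "j < n k"
    have c: "col (Q k) j \<in> carrier_vec (n k)" using Qc[OF k] j by auto
    have "F_chain n X k *\<^sub>v col (Q k * fB1 ?Y k) j = box_vec X (shift1 (e k j))"
      using col_inc[of k j "n k" shift1 "e k", OF k j sh(1)[OF k enum_in[OF k j]]] k by (simp add: shift_datum_def)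
    also have "\<dots> = fB1 X 0 *\<^sub>v (F_chain n X k *\<^sub>v col (Q k) j)" unfolding QF[OF k j] box_vec_simps(2) ..
    also have "\<dots> = F_chain n X k *\<^sub>v col (fB1 X k * Q k) j"
      using chain_mult_B(1)[OF k c] col_mult2[OF D(1)[OF k] Qc[OF k] j] by simp
    finally show "F_chain n X k *\<^sub>v col (Q k * fB1 ?Y k) j = F_chain n X k *\<^sub>v col (fB1 X k * Q k) j" .
  qed (use mult_carrier_mat[OF Qc[OF k] mapsD(1)[OF shift_datum_maps k]] mult_carrier_mat[OF D(1)[OF k] Qc[OF k]] in auto)
  have 2: "Q k * fB2 ?Y k = fB2 X k * Q k" if k: "k < s" for k
  proof (rule mat_cancel[OF chain_inj[OF k]])
    fix j assume j: "j < n k"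
    have c: "col (Q k) j \<in> carrier_vec (n k)" using Qc[OF k] j by auto
    have "F_chain n X k *\<^sub>v col (Q k * fB2 ?Y k) j = box_vec X (shift2 (e k j))"
      using col_inc[of k j "n k" shift2 "e k", OF k j sh(2)[OF k enum_in[OF k j]]] k by (simp add: shift_datum_def)
    also have "\<dots> = fB2 X 0 *\<^sub>v (F_chain n X k *\<^sub>v col (Q k) j)"
      unfolding QF[OF k j] box_vec_shift2[OF ar[OF k enum_in[OF k j]]] ..
    also have "\<dots> = F_chain n X k *\<^sub>v col (fB2 X k * Q k) j"
      using chain_mult_B(2)[OF k c] col_mult2[OF D(2)[OF k] Qc[OF k] j] by simp
    finally show "F_chain n X k *\<^sub>v col (Q k * fB2 ?Y k) j = F_chain n X k *\<^sub>v col (fB2 X k * Q k) j" .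
  qed (use mult_carrier_mat[OF Qc[OF k] mapsD(2)[OF shift_datum_maps k]] mult_carrier_mat[OF D(2)[OF k] Qc[OF k]] in auto)
  have 3: "Q (k - 1) * fF ?Y k = fF X k * Q k" if k: "k \<in> {1..<s}" for k
  proof (rule mat_cancel[OF chain_inj])
    show k1: "k - 1 < s" using k by auto
    have ks: "k < s" "Suc (k - 1) = k" using k by auto
    show "Q (k - 1) * fF ?Y k \<in> carrier_mat (n (k - 1)) (n k)" "fF X k * Q k \<in> carrier_mat (n (k - 1)) (n k)"
      using mult_carrier_mat[OF Qc[OF k1] mapsD(5)[OF shift_datum_maps k]] mult_carrier_mat[OF D(5)[OF k] Qc[OF ks(1)]] .
    fix j assume j: "j < n k"
    have c: "col (Q k) j \<in> carrier_vec (n k)" using Qc[OF ks(1)] j by auto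
    have "E k \<subseteq> E (k - 1)" using E_Suc[of "k - 1"] ks by simp
    then have "e k j \<in> E (k - 1)" using enum_in[OF ks(1) j] by auto
    then have "F_chain n X (k - 1) *\<^sub>v col (Q (k - 1) * fF ?Y k) j = box_vec X (e k j)"
      using col_inc[of "k - 1" j "n k" id "e k", OF k1 j] k by (simp add: shift_datum_def)
    also have "\<dots> = F_chain n X (k - 1) *\<^sub>v (fF X k *\<^sub>v col (Q k) j)"
      using chain_Suc(1)[of "k - 1" "col (Q k) j"] ks QF[OF ks(1) j] c by simp
    also have "\<dots> = F_chain n X (k - 1) *\<^sub>v col (fF X k * Q k) j"
      using col_mult2[OF D(5)[OF k] Qc[OF ks(1)] j] by simp
    finally show "F_chain n X (k - 1) *\<^sub>v col (Q (k - 1) * fF ?Y k) j = F_chain n X (k - 1) *\<^sub>v col (fF X k * Q k) j" .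
  qed
  have 4: "Q 0 * fI ?Y = fI X"
  proof (rule mat_cancel[OF chain_inj[OF s]])
    fix a assume a: "a < r"
    have "(a, 0, 0) \<in> E 0 \<or> box_vec X (a, 0, 0) = 0\<^sub>v (n 0)" using E_0_iff a by auto
    then have "F_chain n X 0 *\<^sub>v col (Q 0 * fI ?Y) a = box_vec X (a, 0, 0)"
      using col_inc[of 0 a r "\<lambda>a. (a, 0, 0)" id, OF s a] by (simp add: shift_datum_def)
    then show "F_chain n X 0 *\<^sub>v col (Q 0 * fI ?Y) a = F_chain n X 0 *\<^sub>v col (fI X) a"
      using D(3) a by (simp add: box_vec_simps(1))
  qed (use mult_carrier_mat[OF Qc[OF s] mapsD(3)[OF shift_datum_maps]] D(3) in auto)
  have 5: "fJ ?Y = fJ X * Q 0" using Qc[OF s] by (simp add: shift_datum_def fJ_zero left_mult_zero_mat)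
  have 6: "Q k * fG ?Y k = fG X k * Q (k - 1)" if k: "k \<in> {1..<s}" for k
  proof -
    have k': "k < s" "k - 1 < s" using k by auto
    show ?thesis using k fG_zero[OF k] Qc[OF k'(1)] Qc[OF k'(2)]
      by (simp add: shift_datum_def left_mult_zero_mat right_mult_zero_mat)
  qed
  have "intertwines s Q ?Y X" unfolding intertwines_def using 1 2 3 4 5 6 by blast
  then show ?thesis using Q by (rule gauge_equivI[rotated])
qed

end

section \<open>Young diagrams\<close>

lemma young_diagram_Sigma: "young_diagram p = (SIGMA i:{..<length p}. {..<p ! i})"
  by (auto simp: young_diagram_def)

lemma young_diagram_down:
  assumes "is_partition p"
  shows "(Suc i, j) \<in> young_diagram p \<Longrightarrow> (i, j) \<in> young_diagram p"
    "(i, Suc j) \<in> young_diagram p \<Longrightarrow> (i, j) \<in> young_diagram p"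
proof -
  assume "(Suc i, j) \<in> young_diagram p"
  then have i: "Suc i < length p" "j < p ! Suc i" by (auto simp: young_diagram_def)
  have "p ! Suc i \<le> p ! i"
    using assms i sorted_wrt_nth_less[of "(\<ge>)" p i "Suc i"] unfolding is_partition_def by simp
  then show "(i, j) \<in> young_diagram p" using i by (simp add: young_diagram_def)
qed (simp add: young_diagram_def)

text \<open>As parts are positive, the boxes \<open>(i, 0)\<close> determine the number of parts;
  each row then determines its part.\<close>

lemma young_diagram_inj:
  assumes p: "is_partition p" and q: "is_partition q" and e: "young_diagram p = young_diagram q"
  shows "p = q"
proof -
  have len: "i < length p \<longleftrightarrow> (i, 0) \<in> young_diagram p" if "is_partition p" for p i
    using that unfolding is_partition_def young_diagram_def by auto
  have "i < length p \<longleftrightarrow> i < length q" for i using len[OF p] len[OF q] e by simp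
  then have l: "length p = length q" by (meson linorder_neqE_nat less_irrefl)
  show ?thesis
  proof (rule nth_equalityI[OF l])
    fix i assume i: "i < length p"
    have "j < p ! i \<longleftrightarrow> (i, j) \<in> young_diagram p" "j < q ! i \<longleftrightarrow> (i, j) \<in> young_diagram q" for j
      using i l by (simp_all add: young_diagram_def)
    then have "j < p ! i \<longleftrightarrow> j < q ! i" for j using e by simp
    then show "p ! i = q ! i" by (meson linorder_neqE_nat less_irrefl)
  qed
qed

lemma down_closed_nat_set:
  fixes A :: "nat set"
  assumes f: "finite A" and d: "\<And>i. Suc i \<in> A \<Longrightarrow> i \<in> A"
  shows "A = {..<card A}"
proof -
  have dn: "i \<in> A" if "j \<in> A" "i \<le> j" for i j
    using that(2,1) by (induction rule: inc_induct) (use d in auto)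
  \<comment> \<open>The least number outside \<open>A\<close> exists by finiteness, and downward
    closure leaves nothing above it.\<close>
  have "A = {..<m}" if "m = (LEAST m. m \<notin> A)" for m
  proof -
    obtain m0 where "m0 \<notin> A" using f infinite_UNIV_nat by (metis ex_new_if_finite)
    then have "m \<notin> A" unfolding that by (rule LeastI)
    moreover have "i \<in> A" if "i < m" for i
      using that not_less_Least \<open>m = (LEAST m. m \<notin> A)\<close> by blast
    ultimately show ?thesis using dn by (metis lessThan_iff linorder_not_le subsetI subset_antisym)
  qed
  then show ?thesis by (metis card_lessThan)
qed

text \<open>Rows and first column of such a set are initial segments: the row lengths are the parts,
  and the first column counts the nonempty rows.\<close>

lemma young_diagram_surj:
  assumes f: "finite S" and d: "\<And>i j. (Suc i, j) \<in> S \<Longrightarrow> (i, j) \<in> S" "\<And>i j. (i, Suc j) \<in> S \<Longrightarrow> (i, j) \<in> S"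
  shows "\<exists>p. is_partition p \<and> young_diagram p = S"
proof -
  define R where "R i = {j. (i, j) \<in> S}" for i
  define C where "C = {i. (i, 0) \<in> S}"
  have fR: "finite (R i)" for i
    by (rule finite_subset[OF _ finite_imageI[OF f, of snd]]) (force simp: R_def)
  have fC: "finite C"
    by (rule finite_subset[OF _ finite_imageI[OF f, of fst]]) (force simp: C_def)
  have R: "R i = {..<card (R i)}" for i
    by (rule down_closed_nat_set[OF fR]) (use d(2) in \<open>simp add: R_def\<close>)
  have C: "C = {..<card C}"
    by (rule down_closed_nat_set[OF fC]) (use d(1) in \<open>simp add: C_def\<close>)
  have RC: "(i, 0) \<in> S" if "(i, j) \<in> S" for i j using that by (induction j) (use d(2) in auto)
  have anti: "R k \<subseteq> R i" if "i \<le> k" for i k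
    using that
  proof (induction rule: inc_induct)
    case (step m)
    have "R (Suc m) \<subseteq> R m" using d(1) by (auto simp: R_def)
    then show ?case using step.IH by blast
  qed simp
  define p where "p = map (\<lambda>i. card (R i)) [0..<card C]"
  have cl: "i < card C \<longleftrightarrow> i \<in> C" for i using C by (metis lessThan_iff)
  have rl: "j < card (R i) \<longleftrightarrow> j \<in> R i" for i j using R by (metis lessThan_iff)
  have "sorted_wrt (\<ge>) p"
    unfolding p_def sorted_wrt_map
    by (rule sorted_wrt_mono_rel[OF _ sorted_wrt_upt]) (use card_mono[OF fR anti] in simp)
  moreover have "0 < card (R i)" if "i < card C" for i
    using that unfolding cl rl by (simp add: C_def R_def)
  then have "\<forall>k\<in>set p. 0 < k" unfolding p_def by auto
  moreover have "young_diagram p = S"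
  proof (rule Set.set_eqI)
    fix x :: "nat \<times> nat"
    obtain i j where x: "x = (i, j)" by (cases x)
    have "x \<in> young_diagram p \<longleftrightarrow> i \<in> C \<and> j \<in> R i"
      unfolding x young_diagram_def p_def by (auto simp: cl rl)
    also have "\<dots> \<longleftrightarrow> x \<in> S" unfolding x C_def R_def using RC by auto
    finally show "x \<in> young_diagram p \<longleftrightarrow> x \<in> S" .
  qed
  ultimately show ?thesis unfolding is_partition_def by blast
qed

section \<open>Diagrams of coloured partitions\<close>

text \<open>The triples follow the convention of \<open>box_vec\<close>: the row index is the
  exponent of \<open>B_1\<close>, the column index that of \<open>B_2\<close>.\<close>

definition coloured_diagram :: "nat list list \<Rightarrow> box set" where
  "coloured_diagram \<mu> = (SIGMA a:{..<length \<mu>}. young_diagram (\<mu> ! a))"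

lemma coloured_diagram_finite: "finite (coloured_diagram \<mu>)"
  unfolding coloured_diagram_def young_diagram_Sigma by auto

lemma card_coloured_diagram: "card (coloured_diagram \<mu>) = coloured_size \<mu>"
  unfolding coloured_diagram_def young_diagram_Sigma coloured_size_def
  by (simp add: sum_list_sum_nth atLeast0LessThan)

lemma coloured_diagram_down:
  assumes "\<mu> \<in> coloured_partitions r"
  shows "shift1 p \<in> coloured_diagram \<mu> \<Longrightarrow> p \<in> coloured_diagram \<mu>"
    "shift2 p \<in> coloured_diagram \<mu> \<Longrightarrow> p \<in> coloured_diagram \<mu>"
proof -
  obtain a i j where p: "p = (a, i, j)" by (cases p)
  have *: "is_partition (\<mu> ! a)" if "a < length \<mu>" using assms that by (auto simp: coloured_partitions_def)
  show "shift1 p \<in> coloured_diagram \<mu> \<Longrightarrow> p \<in> coloured_diagram \<mu>"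
    "shift2 p \<in> coloured_diagram \<mu> \<Longrightarrow> p \<in> coloured_diagram \<mu>"
    unfolding p coloured_diagram_def using young_diagram_down[OF *, of i j] by simp_all
qed

lemma coloured_subset_iff:
  assumes "length \<mu> = length \<nu>"
  shows "coloured_subset \<mu> \<nu> \<longleftrightarrow> coloured_diagram \<mu> \<subseteq> coloured_diagram \<nu>"
  using assms unfolding coloured_subset_def coloured_diagram_def by (force simp: subset_iff)

lemma coloured_diagram_inj:
  assumes "\<mu> \<in> coloured_partitions r" "\<nu> \<in> coloured_partitions r" "coloured_diagram \<mu> = coloured_diagram \<nu>"
  shows "\<mu> = \<nu>"
proof (rule nth_equalityI)
  show l: "length \<mu> = length \<nu>" using assms by (simp add: coloured_partitions_def)
  fix a assume a: "a < length \<mu>"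
  have "coloured_subset \<mu> \<nu>" "coloured_subset \<nu> \<mu>" using assms l by (simp_all add: coloured_subset_iff)
  then have "young_diagram (\<mu> ! a) = young_diagram (\<nu> ! a)" using a l unfolding coloured_subset_def by auto
  then show "\<mu> ! a = \<nu> ! a" using assms(1,2) a l
    by (intro young_diagram_inj) (auto simp: coloured_partitions_def)
qed

lemma coloured_diagram_surj:
  assumes f: "finite T" and r: "T \<subseteq> {..<r} \<times> UNIV"
    and d: "\<And>p. shift1 p \<in> T \<Longrightarrow> p \<in> T" "\<And>p. shift2 p \<in> T \<Longrightarrow> p \<in> T"
  shows "\<exists>\<mu>\<in>coloured_partitions r. coloured_diagram \<mu> = T"
proof -
  have "\<exists>p. is_partition p \<and> young_diagram p = {x. (a, x) \<in> T}" for a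
  proof (rule young_diagram_surj)
    show "finite {x. (a, x) \<in> T}"
      by (rule finite_subset[OF _ finite_imageI[OF f, of snd]]) force
    show "(i, j) \<in> {x. (a, x) \<in> T}" if "(Suc i, j) \<in> {x. (a, x) \<in> T}" for i j
      using d(1)[of "(a, i, j)"] that by simp
    show "(i, j) \<in> {x. (a, x) \<in> T}" if "(i, Suc j) \<in> {x. (a, x) \<in> T}" for i j
      using d(2)[of "(a, i, j)"] that by simp
  qed
  then obtain P where P: "\<And>a. is_partition (P a)" "\<And>a. young_diagram (P a) = {x. (a, x) \<in> T}" by metis
  have "map P [0..<r] \<in> coloured_partitions r" using P(1) by (auto simp: coloured_partitions_def)
  moreover have "coloured_diagram (map P [0..<r]) = T" using r by (auto simp: coloured_diagram_def P(2))
  ultimately show ?thesis by blast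
qed

section \<open>Flags of boxes and nested coloured partitions\<close>

definition flag_of :: "nat list list list \<Rightarrow> nat \<Rightarrow> box set" where
  "flag_of \<mu> k = (if k = 0 then coloured_diagram (\<mu> ! 0)
     else coloured_diagram (\<mu> ! 0) - coloured_diagram (\<mu> ! k))"

text \<open>Complements in the largest diagram reverse the chain and turn downward closure into
  upward closure inside \<open>E 0\<close>.\<close>

lemma flag_of_is_flag:
  assumes s: "2 \<le> s" and \<mu>: "\<mu> \<in> nested_coloured_partitions r s n"
  shows "is_flag r s n (flag_of \<mu>)"
proof -
  let ?D = "\<lambda>k. coloured_diagram (\<mu> ! k)"
  note N = \<mu>[unfolded nested_coloured_partitions_def mem_Collect_eq]
  have cp: "\<mu> ! k \<in> coloured_partitions r" if "k < s" for k using N that nth_mem by blast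
  have len: "length (\<mu> ! k) = r" if "k < s" for k using cp[OF that] by (simp add: coloured_partitions_def)
  have D_Suc: "?D k \<subseteq> ?D (Suc k)" if "1 \<le> k" "Suc k < s" for k
    using N that coloured_subset_iff[of "\<mu> ! k" "\<mu> ! Suc k"] len by auto
  have last: "?D (s - 1) \<subseteq> ?D 0"
    using N coloured_subset_iff[of "\<mu> ! (s - 1)" "\<mu> ! 0"] len[of 0] len[of "s - 1"] s by auto
  \<comment> \<open>The inclusions run upward from \<open>k\<close> to \<open>s - 1\<close> and only
    from there into index 0, hence the induction towards \<open>s - 1\<close>.\<close>
  have sub: "?D k \<subseteq> ?D 0" if "1 \<le> k" "k < s" for k
  proof -
    have "k \<le> s - 1" using that by simp
    then show ?thesis using that(1)
    proof (induction rule: inc_induct)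
      case (step m)
      then have "?D m \<subseteq> ?D (Suc m)" using D_Suc[of m] by simp
      then show ?case using step by simp
    qed (rule last)
  qed
  have down: "shift1 p \<in> ?D k \<Longrightarrow> p \<in> ?D k" "shift2 p \<in> ?D k \<Longrightarrow> p \<in> ?D k" if "k < s" for k p
    using coloured_diagram_down[OF cp[OF that]] by blast+
  have s0: "0 < s" using s by simp
  show ?thesis unfolding is_flag_def
  proof (intro conjI allI ballI impI)
    show "flag_of \<mu> 0 \<subseteq> {..<r} \<times> UNIV" using len[OF s0] by (auto simp: flag_of_def coloured_diagram_def)
    show "p \<in> flag_of \<mu> 0" if "shift1 p \<in> flag_of \<mu> 0" for p using down(1)[OF s0] that by (simp add: flag_of_def)
    show "p \<in> flag_of \<mu> 0" if "shift2 p \<in> flag_of \<mu> 0" for p using down(2)[OF s0] that by (simp add: flag_of_def)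
    show "flag_of \<mu> k \<subseteq> flag_of \<mu> (k - 1)" if "k \<in> {1..<s}" for k
    proof (cases "k = 1")
      case False
      then have k: "1 \<le> k - 1" "Suc (k - 1) = k" "k < s" using that by auto
      then have "?D (k - 1) \<subseteq> ?D k" using D_Suc[of "k - 1"] by metis
      then show ?thesis by (auto simp: flag_of_def)
    qed (auto simp: flag_of_def)
    show "shift1 p \<in> flag_of \<mu> k" if "k < s" "p \<in> flag_of \<mu> k" "shift1 p \<in> flag_of \<mu> 0" for k p
      using down(1)[OF that(1), of p] that(2,3) unfolding flag_of_def by (simp split: if_splits) blast
    show "shift2 p \<in> flag_of \<mu> k" if "k < s" "p \<in> flag_of \<mu> k" "shift2 p \<in> flag_of \<mu> 0" for k p
      using down(2)[OF that(1), of p] that(2,3) unfolding flag_of_def by (simp split: if_splits) blast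
    show "finite (flag_of \<mu> k)" for k by (simp add: flag_of_def coloured_diagram_finite)
    show "card (flag_of \<mu> k) = n k" if k: "k < s" for k
    proof (cases "k = 0")
      case True
      then show ?thesis using N by (simp add: flag_of_def card_coloured_diagram)
    next
      case False
      then have "card (flag_of \<mu> k) = card (?D 0) - card (?D k)"
        using sub[of k] k by (simp add: flag_of_def card_Diff_subset coloured_diagram_finite)
      moreover have "card (?D k) + n k = card (?D 0)" using N k False by (simp add: card_coloured_diagram)
      ultimately show ?thesis by simp
    qed
  qed
qed

lemma flag_of_inj:
  assumes s: "2 \<le> s" and \<mu>: "\<mu> \<in> nested_coloured_partitions r s n" and \<nu>: "\<nu> \<in> nested_coloured_partitions r s n"
    and e: "\<And>k. k < s \<Longrightarrow> flag_of \<mu> k = flag_of \<nu> k"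
  shows "\<mu> = \<nu>"
proof -
  note N = \<mu>[unfolded nested_coloured_partitions_def mem_Collect_eq]
    \<nu>[unfolded nested_coloured_partitions_def mem_Collect_eq]
  have D: "coloured_diagram (\<mu> ! k) = (if k = 0 then flag_of \<mu> 0 else flag_of \<mu> 0 - flag_of \<mu> k)"
    if \<mu>: "\<mu> \<in> nested_coloured_partitions r s n" and k: "k < s" for \<mu> k
  proof (cases "k = 0")
    case False
    note M = \<mu>[unfolded nested_coloured_partitions_def mem_Collect_eq]
    have c: "card (coloured_diagram (\<mu> ! 0)) = n 0" "card (coloured_diagram (\<mu> ! k)) + n k = n 0"
      "card (flag_of \<mu> k) = n k"
      using M k False flag_of_is_flag[OF s \<mu>] by (auto simp: card_coloured_diagram is_flag_def)
    \<comment> \<open>Recovering a diagram from its complement requires containment in the diagram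
      of index 0. Here containment is obtained by counting: the intersection is as large as diagram
      \<open>k\<close>.\<close>
    have "card (coloured_diagram (\<mu> ! 0) \<inter> coloured_diagram (\<mu> ! k)) + card (flag_of \<mu> k) = card (coloured_diagram (\<mu> ! 0))"
      using False card_Int_Diff[OF coloured_diagram_finite, of "\<mu> ! 0" "coloured_diagram (\<mu> ! k)"] by (simp add: flag_of_def Int_commute)
    then have "card (coloured_diagram (\<mu> ! 0) \<inter> coloured_diagram (\<mu> ! k)) = card (coloured_diagram (\<mu> ! k))"
      using c by simp
    then have "coloured_diagram (\<mu> ! 0) \<inter> coloured_diagram (\<mu> ! k) = coloured_diagram (\<mu> ! k)"
      by (intro card_subset_eq coloured_diagram_finite) auto
    then show ?thesis using False by (auto simp: flag_of_def)
  qed (simp add: flag_of_def)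
  show ?thesis
  proof (rule nth_equalityI)
    fix k assume "k < length \<mu>"
    then have k: "k < s" "0 < s" using N by auto
    have "\<mu> ! k \<in> set \<mu>" "\<nu> ! k \<in> set \<nu>" using N k by simp_all
    then have "\<mu> ! k \<in> coloured_partitions r" "\<nu> ! k \<in> coloured_partitions r"
      using N[THEN conjunct2, THEN conjunct1] by auto
    then show "\<mu> ! k = \<nu> ! k"
      by (rule coloured_diagram_inj) (simp only: D[OF \<mu> k(1)] D[OF \<nu> k(1)] e[OF k(1)] e[OF k(2)])
  qed (use N in simp)
qed

lemma flag_of_surj:
  assumes s: "2 \<le> s" and E: "is_flag r s n E"
  shows "\<exists>\<mu>\<in>nested_coloured_partitions r s n. \<forall>k<s. flag_of \<mu> k = E k"
proof -
  have "\<exists>e. bij_betw e {..<n k} (E k)" if "k < s" for k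
    using E that ex_bij_betw_nat_finite[of "E k"] unfolding is_flag_def by (auto simp: atLeast0LessThan)
  then obtain e where "\<And>k. k < s \<Longrightarrow> bij_betw (e k) {..<n k} (E k)" by metis
  \<comment> \<open>The enumeration is arbitrary; the interpretation gives access to the closure
    properties of the flag.\<close>
  then interpret flag_enum r s n E e using s E by unfold_locales auto
  have fin: "finite (E k)" "card (E k) = n k" if "k < s" for k using E that unfolding is_flag_def by auto
  define T where "T k = (if k = 0 then E 0 else E 0 - E k)" for k
  have "\<exists>\<mu>\<in>coloured_partitions r. coloured_diagram \<mu> = T k" if k: "k < s" for k
  proof (rule coloured_diagram_surj)
    show "finite (T k)" "T k \<subseteq> {..<r} \<times> UNIV" using fin[OF s] E_0(3) by (auto simp: T_def)
    show "p \<in> T k" if "shift1 p \<in> T k" for p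
      using that E_0(1)[of p] E_up(1)[OF k, of p] unfolding T_def by (simp split: if_splits) blast
    show "p \<in> T k" if "shift2 p \<in> T k" for p
      using that E_0(2)[of p] E_up(2)[OF k, of p] unfolding T_def by (simp split: if_splits) blast
  qed
  then obtain M where M: "\<And>k. k < s \<Longrightarrow> M k \<in> coloured_partitions r" "\<And>k. k < s \<Longrightarrow> coloured_diagram (M k) = T k"
    by metis
  define \<mu> where "\<mu> = map M [0..<s]"
  have \<mu>: "length \<mu> = s" "\<And>k. k < s \<Longrightarrow> \<mu> ! k = M k" by (simp_all add: \<mu>_def)
  have len: "length (M k) = r" if "k < s" for k using M(1)[OF that] by (simp add: coloured_partitions_def)
  have "coloured_subset (M k) (M (k + 1))" if "k \<in> {1..<s - 1}" for k
  proof -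
    have k: "k < s" "Suc k < s" "k \<noteq> 0" using that by auto
    show ?thesis using M(2) len E_Suc[OF k(2)] k by (subst coloured_subset_iff) (auto simp: T_def)
  qed
  moreover have "coloured_subset (M (s - 1)) (M 0)"
    using s M(2) len by (subst coloured_subset_iff) (auto simp: T_def)
  moreover have "coloured_size (M 0) = n 0" using M(2) s fin by (simp add: T_def flip: card_coloured_diagram)
  moreover have "coloured_size (M k) + n k = n 0" if k: "k \<in> {1..<s}" for k
  proof -
    have ks: "k < s" "k \<noteq> 0" using k by auto
    have "card (T k) = card (E 0) - card (E k)"
      using ks card_Diff_subset[OF fin(1)[OF ks(1)] E_sub_0[OF ks(1)]] by (simp add: T_def)
    \<comment> \<open>Keeps the natural subtraction from truncating, so that the sizes add
      up.\<close>
    moreover have "card (E k) \<le> card (E 0)" using card_mono[OF fin(1)[OF s] E_sub_0[OF ks(1)]] .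
    ultimately show ?thesis using M(2)[OF ks(1)] fin[OF ks(1)] fin[OF s] by (simp flip: card_coloured_diagram)
  qed
  moreover have "set \<mu> \<subseteq> coloured_partitions r" using M(1) by (auto simp: \<mu>_def)
  ultimately have "\<mu> \<in> nested_coloured_partitions r s n"
    unfolding nested_coloured_partitions_def using \<mu> s by auto
  moreover have "flag_of \<mu> k = E k" if "k < s" for k
    using that s M(2) \<mu>(2) E_sub_0[OF that] by (auto simp: flag_of_def T_def)
  ultimately show ?thesis by blast
qed

text \<open>A choice of order for each basis; \<open>normal_form\<close> holds for every
  enumeration, so the orbit does not depend on it.\<close>

definition flag_enumeration :: "(nat \<Rightarrow> nat) \<Rightarrow> (nat \<Rightarrow> box set) \<Rightarrow> nat \<Rightarrow> nat \<Rightarrow> box" where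
  "flag_enumeration n E k = (SOME e. bij_betw e {..<n k} (E k))"

lemma flag_enumeration_bij:
  assumes "is_flag r s n E" "k < s"
  shows "bij_betw (flag_enumeration n E k) {..<n k} (E k)"
proof -
  have "\<exists>e. bij_betw e {..<n k} (E k)"
    using assms ex_bij_betw_nat_finite[of "E k"] unfolding is_flag_def by (auto simp: atLeast0LessThan)
  then show ?thesis unfolding flag_enumeration_def by (rule someI_ex)
qed

section \<open>Fixed points as classes, and the bijection\<close>

definition gauge_class :: "nat \<Rightarrow> nat \<Rightarrow> (nat \<Rightarrow> nat) \<Rightarrow> nested_adhm \<Rightarrow> nested_adhm set" where
  "gauge_class r s n X = {X' \<in> nested_adhm_maps r s n. gauge_equiv s n X X'}"

lemma gauge_class_eq_iff:
  assumes X: "X \<in> nested_adhm_maps r s n" "Y \<in> nested_adhm_maps r s n" and s: "0 < s"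
  shows "gauge_class r s n X = gauge_class r s n Y \<longleftrightarrow> gauge_equiv s n X Y"
proof
  assume e: "gauge_class r s n X = gauge_class r s n Y"
  have "Y \<in> gauge_class r s n X" unfolding e using X gauge_equiv_refl by (simp add: gauge_class_def)
  then show "gauge_equiv s n X Y" by (simp add: gauge_class_def)
next
  assume e: "gauge_equiv s n X Y"
  have "gauge_equiv s n X Z \<longleftrightarrow> gauge_equiv s n Y Z" if Z: "Z \<in> nested_adhm_maps r s n" for Z
    using gauge_equiv_trans[OF X(1,2) Z s e] gauge_equiv_trans[OF X(2,1) Z s gauge_equiv_sym[OF X s e]] by blast
  then show "gauge_class r s n X = gauge_class r s n Y" by (auto simp: gauge_class_def)
qed

text \<open>Moves the fixed-point condition from sets of data to a representative, where gauge
  transformations can be extracted.\<close>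

lemma torus_fixed_points_eq:
  assumes s: "0 < s"
  shows "torus_fixed_points r s n = gauge_class r s n ` {X \<in> nested_adhm_data r s n. stable r s n X \<and>
    (\<forall>t\<in>torus r. gauge_equiv s n X (torus_action r s t X))}" (is "_ = ?R")
proof -
  let ?f = "\<lambda>\<O>. \<forall>t\<in>torus r. torus_action r s t ` \<O> = \<O>"
  have o: "orbit (gauge_group s n) (gauge_action s n) X = gauge_class r s n X"
    and f: "?f (gauge_class r s n X) \<longleftrightarrow> (\<forall>t\<in>torus r. gauge_equiv s n X (torus_action r s t X))"
    if "X \<in> nested_adhm_data r s n" for X
  proof -
    have X: "X \<in> nested_adhm_maps r s n" using that by (simp add: nested_adhm_data_def)
    show "orbit (gauge_group s n) (gauge_action s n) X = gauge_class r s n X"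
      unfolding gauge_class_def by (rule gauge_orbit_eq[OF X s])
    show "?f (gauge_class r s n X) \<longleftrightarrow> (\<forall>t\<in>torus r. gauge_equiv s n X (torus_action r s t X))"
      unfolding gauge_class_def by (rule torus_fixed_orbit_iff[OF X s])
  qed
  have "moduli_space r s n = gauge_class r s n ` {X \<in> nested_adhm_data r s n. stable r s n X}"
    unfolding moduli_space_def orbits_def using o by (auto simp only: image_def mem_Collect_eq)
  then have "torus_fixed_points r s n =
    gauge_class r s n ` {X \<in> nested_adhm_data r s n. stable r s n X \<and> ?f (gauge_class r s n X)}"
    by (simp only: torus_fixed_points_def Compr_image_eq mem_Collect_eq conj_assoc)
  also have "{X \<in> nested_adhm_data r s n. stable r s n X \<and> ?f (gauge_class r s n X)} =
    {X \<in> nested_adhm_data r s n. stable r s n X \<and> (\<forall>t\<in>torus r. gauge_equiv s n X (torus_action r s t X))}"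
    by (intro Collect_cong conj_cong refl f)
  finally show ?thesis .
qed

theorem proposition3p3:
  fixes s r :: nat and n :: "nat \<Rightarrow> nat"
  assumes "2 \<le> s" and "1 \<le> r" and "\<And>i. i < s \<Longrightarrow> 0 < n i"
  shows "\<exists>f. bij_betw f (torus_fixed_points r s n) (nested_coloured_partitions r s n)"
proof -
  have s: "0 < s" using assms(1) by simp
  let ?N = "nested_coloured_partitions r s n"
  define e where "e \<mu> = flag_enumeration n (flag_of \<mu>)" for \<mu>
  \<comment> \<open>The map is built from partitions to orbits, where an explicit datum is
    available, and inverted at the end.\<close>
  define \<Phi> where "\<Phi> \<mu> = gauge_class r s n (shift_datum r s n (e \<mu>))" for \<mu>
  have fe: "flag_enum r s n (flag_of \<mu>) (e \<mu>)" if "\<mu> \<in> ?N" for \<mu>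
    using s flag_of_is_flag[OF assms(1) that] flag_enumeration_bij unfolding e_def
    by (intro flag_enum.intro) auto
  note dmaps = flag_enum.shift_datum_maps[OF fe]
  have "inj_on \<Phi> ?N"
  proof (rule inj_onI)
    fix \<mu> \<nu> assume \<mu>: "\<mu> \<in> ?N" and \<nu>: "\<nu> \<in> ?N" and "\<Phi> \<mu> = \<Phi> \<nu>"
    then have "gauge_equiv s n (shift_datum r s n (e \<mu>)) (shift_datum r s n (e \<nu>))"
      using gauge_class_eq_iff[OF dmaps[OF \<mu>] dmaps[OF \<nu>] s] by (simp add: \<Phi>_def)
    \<comment> \<open>\<open>box_support\<close> is constant on orbits and returns the flag on a
      shift datum.\<close>
    then have "flag_of \<mu> k = flag_of \<nu> k" if "k < s" for k
      using box_support_cong[OF dmaps[OF \<mu>] dmaps[OF \<nu>] that]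
        flag_enum.box_support_shift_datum[OF fe[OF \<mu>] that] flag_enum.box_support_shift_datum[OF fe[OF \<nu>] that]
      by simp
    then show "\<mu> = \<nu>" by (rule flag_of_inj[OF assms(1) \<mu> \<nu>])
  qed
  moreover have "\<Phi> ` ?N = torus_fixed_points r s n"
  proof (intro equalityI subsetI)
    fix \<O> assume "\<O> \<in> \<Phi> ` ?N"
    then show "\<O> \<in> torus_fixed_points r s n"
      unfolding torus_fixed_points_eq[OF s] \<Phi>_def
      using flag_enum.shift_datum_data[OF fe assms(1)] flag_enum.shift_datum_stable[OF fe]
        flag_enum.shift_datum_torus_equiv[OF fe] by blast
  next
    fix \<O> assume "\<O> \<in> torus_fixed_points r s n"
    then obtain X where X: "X \<in> nested_adhm_data r s n" "stable r s n X"
      and fx: "\<And>t. t \<in> torus r \<Longrightarrow> gauge_equiv s n X (torus_action r s t X)" and \<O>: "\<O> = gauge_class r s n X"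
      unfolding torus_fixed_points_eq[OF s] by blast
    have X_maps: "X \<in> nested_adhm_maps r s n" using X(1) by (simp add: nested_adhm_data_def)
    \<comment> \<open>The generic torus element enters through the gauge transformation that
      realises it on \<open>X\<close>.\<close>
    obtain g where "\<And>i. i < s \<Longrightarrow> g i \<in> carrier (GL (n i))"
      "intertwines s g X (torus_action r s (generic_torus_element r) X)"
      using fx[OF generic_torus_element_in] unfolding gauge_equiv_def by blast
    then interpret torus_fixed_datum r s n X g using assms(1) X by unfold_locales
    obtain \<mu> where \<mu>: "\<mu> \<in> ?N" and E: "\<And>k. k < s \<Longrightarrow> flag_of \<mu> k = box_support r n X k"
      using flag_of_surj[OF assms(1) box_support_flag] by blast
    have "gauge_equiv s n (shift_datum r s n (e \<mu>)) X"
      using flag_enum.e[OF fe[OF \<mu>]] E by (intro normal_form) simp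
    then have "\<O> = \<Phi> \<mu>"
      unfolding \<O> \<Phi>_def using gauge_class_eq_iff[OF dmaps[OF \<mu>] X_maps s] by simp
    then show "\<O> \<in> \<Phi> ` ?N" using \<mu> by blast
  qed
  ultimately have "bij_betw \<Phi> ?N (torus_fixed_points r s n)" unfolding bij_betw_def by blast
  then show ?thesis using bij_betw_inv_into by blast
qed

end
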